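(* Let $S\subset\mathbb{N}$ be a finite nonempty set and let $1<r<\infty$. Then: (1) $\bigcap_{n\in S}RH_r^n\neq RH_r$; (2) $\bigcap_{n\in S}A_r^n\neq A_r$; (3) $\bigcap_{n\in S}BMO_n\neq BMO$; (4) $\sum_{n\in S}H^1_n\neq H^1$; (5) $\bigcap_{n\in S}VMO_n\neq VMO$. All these statements hold both over $\mathbb{R}$ and over $\mathbb{T}=[0,1]$.
   Context: $n$-adic intervals are $[\frac{k-1}{n^m},\frac{k}{n^m})$, $m,k\in\mathbb{Z}$ (over $\mathbb{T}$, those contained in $[0,1)$); $\fint_I f=\frac1{|I|}\int_I f$. A weight is a nonnegative locally integrable function; a weight $w$ is $n$-adic doubling if there is $C$ with $C^{-1}\le\int_{J_1}w/\int_{J_2}w\le C$ for all children $J_1,J_2$ of a common $n$-adic interval. $w\in RH_r$ if $(\fint_I w^r)^{1/r}\le C\fint_I w$ for all intervals $I$; $w\in RH_r^n$ if $w$ is $n$-adic doubling and the same inequality holds for all $n$-adic intervals. $w\in A_r$ if $\sup_I(\fint_I w)(\fint_I w^{-1/(r-1)})^{r-1}<\infty$ over all intervals $I$; $A_r^n$ is the same with the supremum over $n$-adic intervals. $f\in BMO$ if $\sup_I\fint_I|f-\fint_If|<\infty$ over all intervals; $BMO_n$ is the same over $n$-adic intervals. On $\mathbb{R}$, $f\in BMO$ is in $VMO$ if (a) $\lim_{\delta\to0}\sup_{|I|<\delta}\fint_I|f-\fint_If|=0$, (b) $\lim_{N\to\infty}\sup_{|I|>N}\fint_I|f-\fint_If|=0$,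 and (c) $\lim_{R\to\infty}\sup_{I\cap B(0,R)=\emptyset}\fint_I|f-\fint_If|=0$; $VMO_n$ is defined for $f\in BMO_n$ by the same conditions with $I$ ranging over $n$-adic intervals. On $\mathbb{T}$ only condition (a) is imposed. $H^1$ is the classical real Hardy space (whose dual is $BMO$, and which is the dual of $VMO$); $H^1_n$ is the $n$-adic Hardy space, consisting of $f=\sum_j\lambda_ja_j$ with $\sum|\lambda_j|<\infty$ and each $a_j$ an $n$-adic atom (supported on an $n$-adic interval $I$, $\int a_j=0$, $\|a_j\|_\infty\le|I|^{-1}$), with dual $BMO_n$ and predual $VMO_n$. $\sum_{n\in S}H^1_n$ is the set of sums $\sum_{n\in S}f_n$ with $f_n\in H^1_n$. *)

theory Defs
  imports "HOL-Analysis.Analysis"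
begin

datatype space = RealLine | Torus

text \<open>The points of the space (for the torus, functions are only looked at on [0,1]).\<close>
fun carrier_set :: "space \<Rightarrow> real set" where
  "carrier_set RealLine = UNIV"
| "carrier_set Torus = {0..1}"

fun intervals :: "space \<Rightarrow> real set set" where
  "intervals RealLine = {{a..b} | a b. a < b}"
| "intervals Torus = {{a..b} | a b. 0 \<le> a \<and> a < b \<and> b \<le> 1}"

definition nadic_all :: "nat \<Rightarrow> real set set" where
  "nadic_all n = {{real_of_int (k - 1) / (real n powi m) ..< real_of_int k / (real n powi m)}
                   | m k :: int. True}"

fun nadic :: "nat \<Rightarrow> space \<Rightarrow> real set set" where
  "nadic n RealLine = nadic_all n"
| "nadic n Torus = {J \<in> nadic_all n. J \<subseteq> {0..<1}}"

definition nchildren :: "nat \<Rightarrow> real set \<Rightarrow> real set set" where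
  "nchildren n J = {J' \<in> nadic_all n. J' \<subseteq> J \<and> measure lborel J' = measure lborel J / real n}"

definition avg :: "real set \<Rightarrow> (real \<Rightarrow> real) \<Rightarrow> real" where
  "avg I f = (LINT x:I|lborel. f x) / measure lborel I"

definition osc :: "real set \<Rightarrow> (real \<Rightarrow> real) \<Rightarrow> real" where
  "osc I f = avg I (\<lambda>x. \<bar>f x - avg I f\<bar>)"

fun locint :: "space \<Rightarrow> (real \<Rightarrow> real) \<Rightarrow> bool" where
  "locint RealLine f = (\<forall>a b. set_integrable lborel {a..b} f)"
| "locint Torus f = set_integrable lborel {0..1} f"

definition weight :: "space \<Rightarrow> (real \<Rightarrow> real) \<Rightarrow> bool" where
  "weight D w \<longleftrightarrow> locint D w \<and> (\<forall>x\<in>carrier_set D. 0 \<le> w x)"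

definition ndoubling :: "nat \<Rightarrow> space \<Rightarrow> (real \<Rightarrow> real) \<Rightarrow> bool" where
  "ndoubling n D w \<longleftrightarrow> (\<exists>C>0. \<forall>J\<in>nadic n D. \<forall>J1\<in>nchildren n J. \<forall>J2\<in>nchildren n J.
      (LINT x:J1|lborel. w x) \<le> C * (LINT x:J2|lborel. w x))"

definition RH_cond :: "real \<Rightarrow> real set set \<Rightarrow> (real \<Rightarrow> real) \<Rightarrow> bool" where
  "RH_cond r \<I> w \<longleftrightarrow> (\<forall>I\<in>\<I>. set_integrable lborel I (\<lambda>x. w x powr r)) \<and>
     (\<exists>C. \<forall>I\<in>\<I>. (avg I (\<lambda>x. w x powr r)) powr (1 / r) \<le> C * avg I w)"

definition RH :: "real \<Rightarrow> space \<Rightarrow> (real \<Rightarrow> real) set" where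
  "RH r D = {w. weight D w \<and> RH_cond r (intervals D) w}"

definition RHn :: "nat \<Rightarrow> real \<Rightarrow> space \<Rightarrow> (real \<Rightarrow> real) set" where
  "RHn n r D = {w. weight D w \<and> ndoubling n D w \<and> RH_cond r (nadic n D) w}"

text \<open>Muckenhoupt A_r condition over a family of intervals. The integrability of
  w^(-1/(r-1)) on each interval and positivity a.e. make the usual convention
  0^(-a) = infinity explicit (Isabelle has 0 powr a = 0).\<close>
definition A_cond :: "real \<Rightarrow> space \<Rightarrow> real set set \<Rightarrow> (real \<Rightarrow> real) \<Rightarrow> bool" where
  "A_cond r D \<I> w \<longleftrightarrow> (AE x in lborel. x \<in> carrier_set D \<longrightarrow> 0 < w x) \<and>
     (\<forall>I\<in>\<I>. set_integrable lborel I (\<lambda>x. w x powr (- 1 / (r - 1)))) \<and>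
     (\<exists>C. \<forall>I\<in>\<I>. avg I w * (avg I (\<lambda>x. w x powr (- 1 / (r - 1)))) powr (r - 1) \<le> C)"

definition A :: "real \<Rightarrow> space \<Rightarrow> (real \<Rightarrow> real) set" where
  "A r D = {w. weight D w \<and> A_cond r D (intervals D) w}"

definition An :: "nat \<Rightarrow> real \<Rightarrow> space \<Rightarrow> (real \<Rightarrow> real) set" where
  "An n r D = {w. weight D w \<and> A_cond r D (nadic n D) w}"

definition BMO_cond :: "real set set \<Rightarrow> (real \<Rightarrow> real) \<Rightarrow> bool" where
  "BMO_cond \<I> f \<longleftrightarrow> (\<exists>C. \<forall>I\<in>\<I>. osc I f \<le> C)"

definition BMO :: "space \<Rightarrow> (real \<Rightarrow> real) set" where
  "BMO D = {f. locint D f \<and> BMO_cond (intervals D) f}"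

definition BMOn :: "nat \<Rightarrow> space \<Rightarrow> (real \<Rightarrow> real) set" where
  "BMOn n D = {f. locint D f \<and> BMO_cond (nadic n D) f}"

fun VMO_cond :: "space \<Rightarrow> real set set \<Rightarrow> (real \<Rightarrow> real) \<Rightarrow> bool" where
  "VMO_cond Torus \<I> f \<longleftrightarrow>
     (\<forall>\<epsilon>>0. \<exists>\<delta>>0. \<forall>I\<in>\<I>. measure lborel I < \<delta> \<longrightarrow> osc I f \<le> \<epsilon>)"
| "VMO_cond RealLine \<I> f \<longleftrightarrow>
     (\<forall>\<epsilon>>0. \<exists>\<delta>>0. \<forall>I\<in>\<I>. measure lborel I < \<delta> \<longrightarrow> osc I f \<le> \<epsilon>) \<and>
     (\<forall>\<epsilon>>0. \<exists>N. \<forall>I\<in>\<I>. measure lborel I > N \<longrightarrow> osc I f \<le> \<epsilon>) \<and>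
     (\<forall>\<epsilon>>0. \<exists>R. \<forall>I\<in>\<I>. I \<inter> ball 0 R = {} \<longrightarrow> osc I f \<le> \<epsilon>)"

definition VMO :: "space \<Rightarrow> (real \<Rightarrow> real) set" where
  "VMO D = {f. f \<in> BMO D \<and> VMO_cond D (intervals D) f}"

definition VMOn :: "nat \<Rightarrow> space \<Rightarrow> (real \<Rightarrow> real) set" where
  "VMOn n D = {f. f \<in> BMOn n D \<and> VMO_cond D (nadic n D) f}"

definition atom :: "real set set \<Rightarrow> (real \<Rightarrow> real) \<Rightarrow> bool" where
  "atom \<I> a \<longleftrightarrow> (\<exists>I\<in>\<I>. a \<in> borel_measurable lborel \<and> (\<forall>x. x \<notin> I \<longrightarrow> a x = 0) \<and>
      (LINT x:I|lborel. a x) = 0 \<and> (\<forall>x. \<bar>a x\<bar> \<le> 1 / measure lborel I))"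

definition atomic_H1 :: "real set set \<Rightarrow> (real \<Rightarrow> real) set" where
  "atomic_H1 \<I> = {f. \<exists>(c :: nat \<Rightarrow> real) (a :: nat \<Rightarrow> real \<Rightarrow> real).
      summable (\<lambda>j. \<bar>c j\<bar>) \<and> (\<forall>j. atom \<I> (a j)) \<and>
      (AE x in lborel. (\<lambda>j. c j * a j x) sums f x)}"

definition H1 :: "space \<Rightarrow> (real \<Rightarrow> real) set" where
  "H1 D = atomic_H1 (intervals D)"

definition H1n :: "nat \<Rightarrow> space \<Rightarrow> (real \<Rightarrow> real) set" where
  "H1n n D = atomic_H1 (nadic n D)"

definition sum_H1n :: "nat set \<Rightarrow> space \<Rightarrow> (real \<Rightarrow> real) set" where
  "sum_H1n S D = {f. \<exists>g :: nat \<Rightarrow> real \<Rightarrow> real. (\<forall>n\<in>S. g n \<in> H1n n D) \<and>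
      f = (\<lambda>x. \<Sum>n\<in>S. g n x)}"

end

(*
  Dirichlet's simultaneous approximation theorem gives points p in (0,1) and scales d such that for
  every n in S some point k/n^m with n^(-m) >= d lies in [p, p + d/K^4], K as large as we like.
  Hence an n-adic interval that is shorter than d does not cross p, up to this tiny error. A bump
  at p may therefore be a truncated inverse square root on the right at the scales d/K^2 .. d and
  on the left at the smaller scales d/K^4 .. d/K^2: on the n-adic intervals only one flank is
  seen, so the bump is an A_1 weight there with constant 3, although at scale d/K^2 it jumps from
  1 to K. A sum W of such bumps with summable coefficients and disjoint supports is again an
  n-adic A_1 weight. It separates the A_r classes, its r-th root the reverse Hoelder classes,
  and the corresponding sum of logarithms the BMO and VMO classes. For H^1, the logarithms of the single
  bumps have bounded n-adic BMO norm, so they pair boundedly with every element of the sum of the n-adic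
  Hardy spaces, but not with a suitable element of H^1.
*)
theory Submission
  imports Defs
begin

section \<open>One bump\<close>

text \<open>The position of the grid point is known only up to an error, and a short n-adic interval
  to its left may already contain the beginning of the plateau. Hence the left side has to climb
  gradually as well. An inverse square root needs scales of ratio \<open>K\<^sup>2\<close> to climb
  from 1 to \<open>K\<close>; two flanks on disjoint ranges of scales lead to
  \<open>d / K\<^sup>2\<close> and \<open>d / K ^ 4\<close>. The estimates are kept in the form
  "mean at most 3 times a lower bound" for the weight and "mean at most 2 above a lower bound" for
  its logarithm, because both forms are additive: lower bounds and means add term by term, so the
  constants survive the infinite sum of bumps. The heights grow so fast that even their logarithms,
  multiplied by the summable coefficients, are unbounded. All bumps lie inside the open unit
  interval, so the same functions serve the line and the torus.\<close>

lemma set_integral_Ico_eq_integral: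
  fixes f :: "real \<Rightarrow> real"
  assumes "continuous_on UNIV f"
  shows "set_integrable lborel {a..<b} f"
    and "(LINT x:{a..<b}|lborel. f x) = integral {a..b} f"
proof -
  have i: "set_integrable lborel {a..b} f"
    by (rule borel_integrable_atLeastAtMost') (use assms continuous_on_subset in blast)
  show "set_integrable lborel {a..<b} f"
    by (rule set_integrable_subset[OF i]) auto
  have "(LINT x:{a..<b}|lborel. f x) = (LINT x:{a..b}|lborel. f x)"
    by (rule set_integral_discrete_difference[where X="{b}"]) auto
  then show "(LINT x:{a..<b}|lborel. f x) = integral {a..b} f"
    using set_borel_integral_eq_integral(2)[OF i] by simp
qed

text \<open>Integrating the majorant with primitive \<open>2 * sqrt (y - p)\<close> leaves
  \<open>sqrt ((b - p) * (a - p))\<close>, which is at least \<open>a - p\<close>. The factor 2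
  comes from the exponent 1/2 and is uniform in the distance of the interval from the
  singularity.\<close>

lemma integral_le_inverse_sqrt:
  fixes F :: "real \<Rightarrow> real"
  assumes cont: "continuous_on UNIV F" and "p \<le> a" "a < b" "0 \<le> F b"
    and bd: "\<And>x. p < x \<Longrightarrow> x \<le> b \<Longrightarrow> F x \<le> sqrt ((b - p) / (x - p)) * F b"
  shows "integral {a..b} F \<le> 2 * (b - a) * F b"
proof -
  \<comment> \<open>If \<open>a = p\<close>, the majorant is infinite at the left endpoint, so
    \<open>g\<close> takes the value of \<open>F\<close> there; the interior form of the fundamental
    theorem ignores that point.\<close>
  define g where "g y = (if y \<le> p then F y else sqrt (b - p) * F b / sqrt (y - p))" for y
  define \<Phi> where "\<Phi> y = 2 * sqrt (b - p) * F b * sqrt (y - p)" for y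
  have "(g has_integral (\<Phi> b - \<Phi> a)) {a..b}"
  proof (rule fundamental_theorem_of_calculus_interior)
    show "a \<le> b" using assms by simp
    show "continuous_on {a..b} \<Phi>" unfolding \<Phi>_def by (intro continuous_intros)
    fix x assume x: "x \<in> {a<..<b}"
    then have "x > p" using assms by auto
    then have "(\<Phi> has_real_derivative g x) (at x)"
      unfolding \<Phi>_def g_def by (auto intro!: derivative_eq_intros simp: field_simps)
    then show "(\<Phi> has_vector_derivative g x) (at x)"
      by (simp add: has_real_derivative_iff_has_vector_derivative)
  qed
  moreover have "F integrable_on {a..b}"
    by (rule integrable_continuous_real) (use cont continuous_on_subset in blast)
  moreover have "F x \<le> g x" if "x \<in> {a..b}" for x
    using bd[of x] that assms by (auto simp: g_def real_sqrt_divide)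
  ultimately have "integral {a..b} F \<le> \<Phi> b - \<Phi> a"
    by (meson has_integral_le integrable_integral)
  also have "\<dots> = 2 * F b * ((b - p) - sqrt ((b - p) * (a - p)))"
  proof -
    have "sqrt (b - p) * sqrt (b - p) = b - p" using assms by simp
    then show ?thesis unfolding \<Phi>_def real_sqrt_mult by algebra
  qed
  also have "\<dots> \<le> 2 * F b * (b - a)"
  proof -
    have "sqrt ((a - p) * (a - p)) \<le> sqrt ((b - p) * (a - p))"
      using assms by (intro real_sqrt_le_mono mult_right_mono) auto
    then have "a - p \<le> sqrt ((b - p) * (a - p))" using assms by simp
    then show ?thesis using assms by (intro mult_left_mono) auto
  qed
  finally show ?thesis by (simp add: mult_ac)
qed

text \<open>The inverse square root \<open>sqrt (d / x)\<close>, cut off below at 1 from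
  \<open>x = d\<close> on and frozen for \<open>x \<le> e\<close>. The plateau includes all negative
  arguments, so that two opposite spikes can be combined by \<open>min\<close>.\<close>

definition spike :: "real \<Rightarrow> real \<Rightarrow> real \<Rightarrow> real" where
  "spike d e x = max 1 (sqrt (d / max x e))"

lemma continuous_on_spike:
  assumes "e > 0" "continuous_on S f"
  shows "continuous_on S (\<lambda>x. spike d e (f x))"
  unfolding spike_def using assms by (intro continuous_intros) auto

lemma spike_ge_1: "1 \<le> spike d e x"
  by (simp add: spike_def)

lemma spike_eq_1:
  assumes "0 < d" "d \<le> x"
  shows "spike d e x = 1"
proof -
  have "d / max x e \<le> 1" using assms by (subst divide_le_eq) auto
  then show ?thesis by (simp add: spike_def)
qed

lemma spike_eq_top:
  assumes "x \<le> e"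
  shows "spike d e x = max 1 (sqrt (d / e))"
  using assms by (simp add: spike_def max_def)

lemma spike_antimono:
  assumes "0 < e" "0 < d" "x \<le> y"
  shows "spike d e y \<le> spike d e x"
proof -
  have "d / max y e \<le> d / max x e" using assms by (intro divide_left_mono) auto
  then show ?thesis by (auto simp: spike_def le_max_iff_disj)
qed

lemma spike_le_top:
  assumes "0 < e" "0 < d"
  shows "spike d e x \<le> max 1 (sqrt (d / e))"
  using spike_antimono[OF assms, of "min x e" x] spike_eq_top[of "min x e" e d] by simp

text \<open>Equivalent to monotonicity of \<open>sqrt x * spike d e x\<close>, which holds because
  \<open>x / max x e\<close> is nondecreasing.\<close>

lemma spike_le_sqrt:
  assumes "0 < e" "0 < d" "0 < x" "x \<le> b"
  shows "spike d e x \<le> sqrt (b / x) * spike d e b"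
proof -
  have 1: "1 \<le> sqrt (b / x)" using assms by simp
  have "d / max x e \<le> (b / x) * (d / max b e)"
  proof -
    have "x * max b e \<le> b * max x e"
    proof (cases "b \<le> e")
      case True
      then show ?thesis using assms by (simp add: max_def mult_right_mono)
    next
      case False
      then show ?thesis using assms by (simp add: max_def mult.commute)
    qed
    then show ?thesis using assms by (simp add: field_simps)
  qed
  then have "sqrt (d / max x e) \<le> sqrt (b / x) * sqrt (d / max b e)"
    by (metis real_sqrt_le_mono real_sqrt_mult)
  also have "\<dots> \<le> sqrt (b / x) * spike d e b"
    using 1 by (intro mult_left_mono) (auto simp: spike_def)
  finally have 2: "sqrt (d / max x e) \<le> sqrt (b / x) * spike d e b" .
  have "1 * 1 \<le> sqrt (b / x) * spike d e b"
    using 1 by (intro mult_mono spike_ge_1) auto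
  with 2 show ?thesis by (simp add: spike_def)
qed

lemma integral_spike_le:
  assumes "0 < e" "0 < d" "p \<le> a" "a < b"
  shows "integral {a..b} (\<lambda>x. spike d e (x - p)) \<le> 2 * (b - a) * spike d e (b - p)"
proof (rule integral_le_inverse_sqrt)
  show "continuous_on UNIV (\<lambda>x. spike d e (x - p))"
    using assms by (intro continuous_on_spike continuous_intros)
qed (use assms spike_ge_1[of d e "b - p"] in \<open>auto intro!: spike_le_sqrt\<close>)

lemma integral_spike_reflect_le:
  assumes "0 < e" "0 < d" "b \<le> q" "a < b"
  shows "integral {a..b} (\<lambda>x. spike d e (q - x)) \<le> 2 * (b - a) * spike d e (q - a)"
proof -
  have "integral {a..b} (\<lambda>x. spike d e (q - x)) = integral {- b..- a} (\<lambda>x. spike d e (x - (- q)))"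
    using Henstock_Kurzweil_Integration.integral_reflect_real[of b a "\<lambda>x. spike d e (q - x)"] by (simp add: add.commute)
  also have "\<dots> \<le> 2 * (- a - - b) * spike d e (- a - - q)"
    using assms by (intro integral_spike_le) auto
  finally show ?thesis by simp
qed

text \<open>The left and right flanks live on separated ranges of scales: to the right of \<open>p\<close> the bump
  decays on the scales between \<open>d / K\<^sup>2\<close> and \<open>d\<close>, to the left on those between
  \<open>d / K ^ 4\<close> and \<open>d / K\<^sup>2\<close>.\<close>

definition bump :: "real \<Rightarrow> real \<Rightarrow> real \<Rightarrow> real \<Rightarrow> real" where
  "bump p d K x = min (spike d (d / K\<^sup>2) (x - p)) (spike (d / K\<^sup>2) (d / K ^ 4) (p + d / K ^ 4 - x))"

section \<open>A_1 estimates for a single bump\<close>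

context
  fixes p d K :: real
  assumes d: "0 < d" and K: "1 \<le> K"
begin

lemma bump_scales: "d / K ^ 4 \<le> d / K\<^sup>2" "d / K\<^sup>2 \<le> d" "0 < d / K ^ 4" "0 < d / K\<^sup>2"
proof -
  have "K\<^sup>2 \<le> K ^ 4" by (rule power_increasing) (use K in auto)
  then show "d / K ^ 4 \<le> d / K\<^sup>2" using d K by (intro divide_left_mono) auto
  have "1 \<le> K\<^sup>2" using K by simp
  then show "d / K\<^sup>2 \<le> d" using d by (simp add: divide_le_eq)
qed (use d K in auto)

text \<open>Both ratios of scales are \<open>K\<^sup>2\<close>, so the two plateaus have the same
  height; where one spike is on its plateau, the minimum in \<open>bump\<close> is therefore the
  other spike.\<close>

lemma bump_tops:
  "max 1 (sqrt (d / (d / K\<^sup>2))) = K" "max 1 (sqrt ((d / K\<^sup>2) / (d / K ^ 4))) = K"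
proof -
  have "(d / K\<^sup>2) / (d / K ^ 4) = K\<^sup>2" using d K by (simp add: field_simps power2_eq_square power4_eq_xxxx)
  then show "max 1 (sqrt ((d / K\<^sup>2) / (d / K ^ 4))) = K" using K by simp
qed (use d K in simp)

lemma continuous_on_bump: "continuous_on S (bump p d K)"
  unfolding bump_def[abs_def] using bump_scales
  by (intro continuous_intros continuous_on_spike) auto

lemma bump_ge_1: "1 \<le> bump p d K x"
  by (simp add: bump_def spike_ge_1)

lemma bump_le: "bump p d K x \<le> K"
  using spike_le_top[of "d / K\<^sup>2" d "x - p"] bump_tops bump_scales d by (simp add: bump_def)

text \<open>The ranges of this formula and of \<open>bump_right\<close> overlap on
  \<open>[p, p + d / K ^ 4]\<close>, where both give \<open>K\<close>. The overlap absorbs the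
  approximation error: a grid point anywhere in it has a single flank on each side.\<close>

lemma bump_left: "x \<le> p + d / K ^ 4 \<Longrightarrow> bump p d K x = spike (d / K\<^sup>2) (d / K ^ 4) (p + d / K ^ 4 - x)"
  using spike_eq_top[of "x - p" "d / K\<^sup>2" d] bump_tops bump_scales d
    spike_le_top[of "d / K ^ 4" "d / K\<^sup>2"] by (simp add: bump_def)

lemma bump_right: "p \<le> x \<Longrightarrow> bump p d K x = spike d (d / K\<^sup>2) (x - p)"
  using spike_eq_top[of "p + d / K ^ 4 - x" "d / K ^ 4" "d / K\<^sup>2"] bump_tops bump_scales d
    spike_le_top[of "d / K\<^sup>2" "d"] by (simp add: bump_def)

lemma bump_eq_1_left: "x \<le> p - d / K\<^sup>2 \<Longrightarrow> bump p d K x = 1"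
  using bump_left[of x] bump_scales spike_eq_1[of "d / K\<^sup>2" "p + d / K ^ 4 - x"] by simp

lemma bump_eq_1_right: "p + d \<le> x \<Longrightarrow> bump p d K x = 1"
  using bump_right[of x] spike_eq_1[of d "x - p"] d by simp

lemma bump_eq_top: "p \<le> x \<Longrightarrow> x \<le> p + d / K\<^sup>2 \<Longrightarrow> bump p d K x = K"
  using bump_right[of x] spike_eq_top[of "x - p" "d / K\<^sup>2" d] bump_tops by simp

text \<open>On the right flank the bump is nonincreasing, so its value at the far end
  \<open>b\<close> is a lower bound, and the spike estimate compares the mean with that same
  value.\<close>

lemma bump_A1_right:
  assumes "p \<le> a" "a < b"
  shows "\<exists>m\<ge>1. (\<forall>x\<in>{a..<b}. m \<le> bump p d K x) \<and> integral {a..b} (bump p d K) \<le> 2 * m * (b - a)"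
proof (intro exI conjI ballI)
  let ?m = "spike d (d / K\<^sup>2) (b - p)"
  show "?m \<ge> 1" by (rule spike_ge_1)
  show "?m \<le> bump p d K x" if "x \<in> {a..<b}" for x
    using that assms bump_right[of x] spike_antimono[of "d / K\<^sup>2" d] bump_scales d by simp
  have "integral {a..b} (bump p d K) = integral {a..b} (\<lambda>x. spike d (d / K\<^sup>2) (x - p))"
    using assms by (intro integral_cong bump_right) auto
  also have "\<dots> \<le> 2 * (b - a) * ?m" using assms bump_scales d by (intro integral_spike_le)
  finally show "integral {a..b} (bump p d K) \<le> 2 * ?m * (b - a)" by (simp only: mult_ac)
qed

lemma bump_A1_left:
  assumes "b \<le> p + d / K ^ 4" "a < b"
  shows "\<exists>m\<ge>1. (\<forall>x\<in>{a..<b}. m \<le> bump p d K x) \<and> integral {a..b} (bump p d K) \<le> 2 * m * (b - a)"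
proof (intro exI conjI ballI)
  let ?m = "spike (d / K\<^sup>2) (d / K ^ 4) (p + d / K ^ 4 - a)"
  show "?m \<ge> 1" by (rule spike_ge_1)
  show "?m \<le> bump p d K x" if "x \<in> {a..<b}" for x
    using that assms bump_left[of x] spike_antimono[of "d / K ^ 4" "d / K\<^sup>2"] bump_scales d by simp
  have "integral {a..b} (bump p d K) = integral {a..b} (\<lambda>x. spike (d / K\<^sup>2) (d / K ^ 4) (p + d / K ^ 4 - x))"
    using assms by (intro integral_cong bump_left) auto
  also have "\<dots> \<le> 2 * (b - a) * ?m" using assms bump_scales d by (intro integral_spike_reflect_le)
  finally show "integral {a..b} (bump p d K) \<le> 2 * ?m * (b - a)" by (simp only: mult_ac)
qed

lemma integrable_bump: "(\<lambda>x. bump p d K x) integrable_on {a..b}"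
  by (rule integrable_continuous_real[OF continuous_on_bump])

text \<open>Each half has integral at most \<open>2 * d\<close>, because its spike has dropped to 1
  at distance \<open>d\<close>; removing the constant 1 leaves a mass that does not depend on
  \<open>K\<close>.\<close>

lemma integral_bump_excess: "integral {p - d..p + d} (\<lambda>x. bump p d K x - 1) \<le> 2 * d"
proof -
  have 1: "integral {p..p + d} (bump p d K) \<le> 2 * d"
    using integral_spike_le[of "d / K\<^sup>2" d p p "p + d"] bump_scales d spike_eq_1[of d d]
      integral_cong[of "{p..p + d}" "bump p d K" "\<lambda>x. spike d (d / K\<^sup>2) (x - p)"] bump_right
    by simp
  have 2: "integral {p - d..p} (bump p d K) \<le> 2 * d"
    using integral_spike_reflect_le[of "d / K ^ 4" "d / K\<^sup>2" p "p + d / K ^ 4" "p - d"] bump_scales d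
      spike_eq_1[of "d / K\<^sup>2" "d / K ^ 4 + d"] bump_left
      integral_cong[of "{p - d..p}" "bump p d K" "\<lambda>x. spike (d / K\<^sup>2) (d / K ^ 4) (p + d / K ^ 4 - x)"]
    by simp
  have "integral {p - d..p + d} (bump p d K) = integral {p - d..p} (bump p d K) + integral {p..p + d} (bump p d K)"
    using d Henstock_Kurzweil_Integration.integral_combine[OF _ _ integrable_bump, of "p - d" p "p + d"] by simp
  then have "integral {p - d..p + d} (bump p d K) \<le> 4 * d" using 1 2 by simp
  moreover have "integral {p - d..p + d} (\<lambda>x. bump p d K x - 1) = integral {p - d..p + d} (bump p d K) - 2 * d"
    using d by (subst integral_diff[OF integrable_bump]) auto
  ultimately show ?thesis by simp
qed

lemma bump_excess_support: "x \<notin> {p - d..p + d} \<Longrightarrow> bump p d K x - 1 = 0"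
  using bump_eq_1_left[of x] bump_eq_1_right[of x] bump_scales by auto

lemma bump_excess_eq_indicator:
  "indicator {p - d..p + d} x *\<^sub>R (bump p d K x - 1) = bump p d K x - 1"
  using bump_excess_support[of x] by (auto simp: indicator_def)

lemma bump_excess_integrable:
  "integrable lborel (\<lambda>x. bump p d K x - 1)" "(\<integral>x. bump p d K x - 1 \<partial>lborel) \<le> 2 * d"
proof -
  have i: "set_integrable lborel {p - d..p + d} (\<lambda>x. bump p d K x - 1)"
    by (rule borel_integrable_atLeastAtMost') (intro continuous_intros continuous_on_bump)
  then show "integrable lborel (\<lambda>x. bump p d K x - 1)"
    unfolding set_integrable_def bump_excess_eq_indicator .
  show "(\<integral>x. bump p d K x - 1 \<partial>lborel) \<le> 2 * d"
    using set_borel_integral_eq_integral(2)[OF i] integral_bump_excess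
    unfolding set_lebesgue_integral_def bump_excess_eq_indicator by simp
qed

text \<open>No information on the position is required here: an excess mass of at most
  \<open>2 * d\<close>, spread over a length of at least \<open>d\<close>, adds at most 2 to the
  mean 1.\<close>

lemma bump_A1_long:
  assumes "d \<le> b - a"
  shows "integral {a..b} (bump p d K) \<le> 3 * (b - a)"
proof -
  have "integral {a..b} (\<lambda>x. bump p d K x - 1) = (LINT x:{a..<b}|lborel. bump p d K x - 1)"
    by (subst set_integral_Ico_eq_integral(2)) (intro continuous_intros continuous_on_bump refl)+
  also have "\<dots> \<le> (\<integral>x. bump p d K x - 1 \<partial>lborel)"
    unfolding set_lebesgue_integral_def
    by (intro integral_mono set_integral_Ico_eq_integral[unfolded set_integrable_def] bump_excess_integrable)
       (auto intro!: continuous_intros continuous_on_bump simp: indicator_def bump_ge_1)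
  also have "\<dots> \<le> 2 * d" by (rule bump_excess_integrable)
  finally have "integral {a..b} (\<lambda>x. bump p d K x - 1) \<le> 2 * d" .
  moreover have "integral {a..b} (\<lambda>x. bump p d K x - 1) = integral {a..b} (bump p d K) - (b - a)"
    using d assms by (subst integral_diff[OF integrable_bump]) auto
  ultimately show ?thesis using assms by simp
qed

text \<open>The assumption leaves out only the intervals shorter than \<open>d\<close> that extend
  beyond both ends of \<open>[p, p + d / K ^ 4]\<close>; these see both flanks.\<close>

lemma bump_A1:
  assumes "a < b" and "d \<le> b - a \<or> b \<le> p + d / K ^ 4 \<or> p \<le> a"
  shows "\<exists>m\<ge>1. (\<forall>x\<in>{a..<b}. m \<le> bump p d K x) \<and>
           (LINT x:{a..<b}|lborel. bump p d K x) \<le> 3 * m * (b - a)"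
proof -
  have "\<exists>m\<ge>1. (\<forall>x\<in>{a..<b}. m \<le> bump p d K x) \<and> integral {a..b} (bump p d K) \<le> 3 * m * (b - a)"
    using assms(2)
  proof (elim disjE)
    assume "d \<le> b - a"
    then show ?thesis using bump_A1_long bump_ge_1 by (intro exI[of _ 1]) auto
  next
    have *: "2 * m * (b - a) \<le> 3 * m * (b - a)" if "m \<ge> 1" for m
      using that assms(1) by (intro mult_right_mono) auto
    { assume "b \<le> p + d / K ^ 4"
      then show ?thesis using bump_A1_left[OF _ assms(1)] * by (meson order_trans) }
    assume "p \<le> a"
    then show ?thesis using bump_A1_right[OF _ assms(1)] * by (meson order_trans)
  qed
  then show ?thesis
    by (subst set_integral_Ico_eq_integral(2)[OF continuous_on_bump])
qed

end

section \<open>Bumps near n-adic points of every base\<close>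

text \<open>The n-adic grids are nested. An interval of level at most \<open>M\<close> is long; at a
  finer level the point \<open>i / n ^ M\<close> is itself a grid point with numerator
  \<open>i * n ^ e\<close>, so an interval between consecutive grid points lies on one side of it.
  The instance \<open>d = 0\<close>, \<open>M = 0\<close> merely extracts endpoints.\<close>

lemma nadic_cases:
  assumes J: "J \<in> nadic_all n" and n: "2 \<le> n" and d: "d \<le> 1 / real n ^ M"
  obtains a b where "J = {a..<b}" "a < b"
    "d \<le> b - a \<or> b \<le> of_int i / real n ^ M \<or> of_int i / real n ^ M \<le> a"
proof -
  obtain m k :: int where J: "J = {real_of_int (k - 1) / (real n powi m) ..< real_of_int k / (real n powi m)}"
    using J unfolding nadic_all_def by blast
  let ?a = "real_of_int (k - 1) / (real n powi m)" and ?b = "real_of_int k / (real n powi m)"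
  have pos: "0 < real n powi m" using n by (intro zero_less_power_int) auto
  have len: "?b - ?a = 1 / (real n powi m)" by (simp add: diff_divide_distrib)
  have lt: "?a < ?b" using pos by (intro divide_strict_right_mono) auto
  have "d \<le> ?b - ?a \<or> ?b \<le> of_int i / real n ^ M \<or> of_int i / real n ^ M \<le> ?a"
  proof (cases "m \<le> int M")
    case True
    have "real n powi m \<le> real n powi int M"
      using n True by (intro power_int_increasing) auto
    then have "1 / real n ^ M \<le> 1 / (real n powi m)"
      using pos n by (intro divide_left_mono) auto
    then show ?thesis using d len by linarith
  next
    case False
    then obtain e where m: "m = int (M + e)"
      using zle_iff_zadd[of "int M" m] by auto
    have eq: "of_int i / real n ^ M = of_int (i * int n ^ e) / (real n powi m)"
      using n by (simp add: m power_add del: of_nat_add)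
    have "k \<le> i * int n ^ e \<or> i * int n ^ e \<le> k - 1" by linarith
    then show ?thesis
      unfolding eq using pos
      by (auto intro!: divide_right_mono simp only: of_int_le_iff)
  qed
  with lt show thesis using that J by blast
qed

lemma exists_power_between:
  assumes "2 \<le> n" "0 < d" "d \<le> 1"
  obtains M where "d \<le> 1 / real n ^ M" "1 / real n ^ M \<le> real n * d"
proof -
  define P where "P M \<longleftrightarrow> 1 / real n ^ M < d" for M
  have "\<exists>M. P M"
    using real_arch_pow_inv[of d "1 / real n"] assms by (auto simp: P_def power_divide)
  moreover have "\<not> P 0" using assms by (simp add: P_def)
  ultimately obtain M where "\<not> P M" "P (Suc M)"
    by (metis LeastI_ex not_less_Least not0_implies_Suc lessI)
  then show thesis
    using assms by (intro that[of M]) (auto simp: P_def field_simps)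
qed

text \<open>For each base pick a level whose mesh is comparable to \<open>d\<close>. Dirichlet's
  theorem gives one multiple of \<open>4 * d\<close> that is close to the grid of every base at
  once, relative to its mesh.\<close>

lemma nearby_nadic_points:
  fixes S :: "nat set" and K u :: real
  assumes S: "finite S" "\<forall>n\<in>S. 2 \<le> n" and K: "1 \<le> K" and u: "0 < u"
  obtains p d where "0 < d" "d < p" "p + d < u"
    "\<And>n. n \<in> S \<Longrightarrow> \<exists>M (i::int). d \<le> 1 / real n ^ M \<and> p \<le> of_int i / real n ^ M \<and>
        of_int i / real n ^ M \<le> p + d / K"
proof -
  obtain g where g: "bij_betw g {..<card S} S"
    using S(1) bij_betw_from_nat_into_finite by blast
  define m where "m = Max (insert 2 S)"
  have m: "2 \<le> m" "\<And>n. n \<in> S \<Longrightarrow> n \<le> m"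
    using S(1) by (auto simp: m_def)
  \<comment> \<open>The mesh is at most \<open>m * d\<close>, so a relative error
    \<open>1 / N\<close> becomes at most \<open>d / (2 * K)\<close>.\<close>
  obtain N :: nat where N: "2 * real m * K < real N" using reals_Archimedean2 by blast
  have N0: "N > 0" using N m K
    by (metis mult_nonneg_nonneg of_nat_0 of_nat_0_le_iff not_less gr0I less_eq_real_def
        order_trans zero_le_numeral zero_le_one)
  define B where "B = real (N ^ card S)"
  have B: "1 \<le> B" using N0 by (simp add: B_def Suc_leI)
  \<comment> \<open>\<open>N\<close> and hence the bound \<open>B\<close> on the Dirichlet
    multiplier \<open>q\<close> are fixed before \<open>d\<close>. So \<open>d\<close> can be taken
    small enough that \<open>q * (4 * d)\<close>, at most \<open>4 * B * d\<close>, leaves room for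
    another \<open>d\<close> below \<open>u\<close>.\<close>
  define d where "d = min 1 u / (8 * B)"
  have d: "0 < d" "d \<le> 1" "8 * B * d \<le> u"
  proof -
    show "0 < d" using u B by (simp add: d_def)
    have "min 1 u \<le> 8 * B" using B by linarith
    then show "d \<le> 1" using B by (simp add: d_def divide_le_eq)
    show "8 * B * d \<le> u" using B by (simp add: d_def)
  qed
  have "\<exists>M. d \<le> 1 / real n ^ M \<and> 1 / real n ^ M \<le> real n * d" if "n \<in> S" for n
    using exists_power_between[of n d] bspec[OF S(2) that] d by metis
  then obtain M where M: "\<And>n. n \<in> S \<Longrightarrow> d \<le> 1 / real n ^ M n \<and> 1 / real n ^ M n \<le> real n * d"
    by metis
  obtain q k where q: "0 < q" "q \<le> int (N ^ card S)"
    and k: "\<And>i. i < card S \<Longrightarrow> \<bar>of_int q * (4 * d * real (g i) ^ M (g i)) - of_int (k i)\<bar> < 1 / N"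
    using Dirichlet_approx_simult[OF N0, of "card S" "\<lambda>i. 4 * d * real (g i) ^ M (g i)"] by blast
  \<comment> \<open>The shift by \<open>d / (2 * K)\<close> turns the two-sided approximation error
    into the one-sided range from \<open>p\<close> to \<open>p + d / K\<close>. As
    \<open>q \<ge> 1\<close>, the factor 4 keeps \<open>p\<close> above \<open>d\<close>.\<close>
  define p where "p = of_int q * (4 * d) - d / (2 * K)"
  have qB: "1 \<le> real_of_int q" "real_of_int q \<le> B"
    using q by (auto simp: B_def simp del: of_nat_power)
  have dK: "0 < d / (2 * K)" "d / (2 * K) \<le> d / 2" "d / (2 * K) + d / (2 * K) = d / K"
    using d K by (auto simp: field_simps)
  have q4: "4 * d \<le> of_int q * (4 * d)" "of_int q * (4 * d) \<le> B * (4 * d)"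
    using qB d by (auto intro: mult_right_mono)
  show thesis
  proof (rule that)
    show "0 < d" by (rule d)
    show "d < p" unfolding p_def using q4 dK d by linarith
    have "1 * d \<le> B * d" using B d by (intro mult_right_mono) auto
    then show "p + d < u" unfolding p_def using q4 dK d B by linarith
    fix n assume n: "n \<in> S"
    then obtain i where i: "i < card S" "n = g i"
      using g by (metis bij_betw_imp_surj_on imageE lessThan_iff)
    let ?x = "real n ^ M n"
    have x: "0 < ?x" using bspec[OF S(2) n] by simp
    have "of_int q * (4 * d) - of_int (k i) / ?x = (of_int q * (4 * d * ?x) - of_int (k i)) / ?x"
      using x by (simp add: field_simps)
    then have "\<bar>of_int q * (4 * d) - of_int (k i) / ?x\<bar> = \<bar>of_int q * (4 * d * ?x) - of_int (k i)\<bar> * (1 / ?x)"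
      using x by (simp add: abs_divide)
    also have "\<dots> \<le> (1 / N) * (real m * d)"
    proof (rule mult_mono)
      show "\<bar>of_int q * (4 * d * ?x) - of_int (k i)\<bar> \<le> 1 / N" using k[OF i(1)] i(2) by simp
      have "real n * d \<le> real m * d" using m(2)[OF n] d by (intro mult_right_mono) auto
      then show "1 / ?x \<le> real m * d" using M[OF n] by linarith
    qed (use x in auto)
    also have "\<dots> \<le> d / (2 * K)"
    proof -
      have "d * (2 * real m * K) \<le> d * real N" using N d by (intro mult_left_mono) auto
      then show ?thesis using N0 K by (simp add: field_simps)
    qed
    finally have "\<bar>of_int q * (4 * d) - of_int (k i) / ?x\<bar> \<le> d / (2 * K)" .
    then show "\<exists>M (i::int). d \<le> 1 / real n ^ M \<and> p \<le> of_int i / real n ^ M \<and>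
        of_int i / real n ^ M \<le> p + d / K"
      using M[OF n] dK unfolding p_def by (intro exI[of _ "M n"] exI[of _ "k i"]) linarith
  qed
qed

text \<open>Matched to \<open>coef j\<close>, which is \<open>2\<close> to the power
  \<open>- (j + 1)\<close>: the product \<open>coef j * ln (height j)\<close> is
  \<open>2 ^ Suc j\<close>, hence unbounded.\<close>

definition height :: "nat \<Rightarrow> real" where
  "height j = exp (4 ^ Suc j)"

lemma height_ge: "4 ^ Suc j \<le> height j" "4 \<le> height j"
proof -
  show "4 ^ Suc j \<le> height j"
    unfolding height_def using exp_ge_add_one_self[of "4 ^ Suc j"] by linarith
  moreover have "(4::real) ^ 1 \<le> 4 ^ Suc j" by (rule power_increasing) auto
  ultimately show "4 \<le> height j" by (metis order_trans power_one_right)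
qed

text \<open>Each bump is placed to the left of the support of its predecessor and to the right of 0,
  which the arbitrary upper bound \<open>u\<close> in \<open>nearby_nadic_points\<close> permits. In
  \<open>near\<close>, the tolerance is the width of the overlap of the flanks for
  \<open>K = height j\<close>.\<close>

locale bump_chain =
  fixes S :: "nat set" and p d :: "nat \<Rightarrow> real"
  assumes S_ge: "n \<in> S \<Longrightarrow> 2 \<le> n"
    and d_pos: "0 < d j" and d_less_p: "d j < p j" and first: "p 0 + d 0 < 1"
    and chain: "p (Suc j) + d (Suc j) < p j - d j"
    and near: "n \<in> S \<Longrightarrow> \<exists>M (i::int). d j \<le> 1 / real n ^ M \<and> p j \<le> of_int i / real n ^ M \<and>
        of_int i / real n ^ M \<le> p j + d j / height j ^ 4"

lemma bump_chain_exists: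
  fixes S :: "nat set"
  assumes S: "finite S" "\<forall>n\<in>S. 2 \<le> n"
  obtains p d where "bump_chain S p d"
proof -
  define P where "P j x \<longleftrightarrow> 0 < snd x \<and> snd x < fst x \<and> fst x + snd x < 1 \<and>
    (\<forall>n\<in>S. \<exists>M (i::int). snd x \<le> 1 / real n ^ M \<and> fst x \<le> of_int i / real n ^ M \<and>
        of_int i / real n ^ M \<le> fst x + snd x / height j ^ 4)" for j and x :: "real \<times> real"
  define Q where "Q j x y \<longleftrightarrow> fst y + snd y < fst x - snd x" for j :: nat and x y :: "real \<times> real"
  have step: "\<exists>y. P j y \<and> fst y + snd y < u" if u: "0 < u" for j u
  proof -
    have K: "1 \<le> height j ^ 4" using height_ge(2)[of j] by (intro one_le_power) auto
    have u': "0 < min u 1" using u by simp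
    obtain p d where "0 < d" "d < p" "p + d < min u 1"
      "\<And>n. n \<in> S \<Longrightarrow> \<exists>M (i::int). d \<le> 1 / real n ^ M \<and> p \<le> of_int i / real n ^ M \<and>
        of_int i / real n ^ M \<le> p + d / height j ^ 4"
      by (rule nearby_nadic_points[OF S K u']) (rule that)
    then show ?thesis by (intro exI[of _ "(p, d)"]) (auto simp: P_def)
  qed
  have "\<exists>f. \<forall>j. P j (f j) \<and> Q j (f j) (f (Suc j))"
  proof (rule dependent_nat_choice)
    show "\<exists>x. P 0 x" using step[of 1 0] by auto
    show "\<exists>y. P (Suc j) y \<and> Q j x y" if "P j x" for x j
      using step[of "fst x - snd x" "Suc j"] that by (auto simp: P_def Q_def)
  qed
  then obtain f where "\<And>j. P j (f j) \<and> Q j (f j) (f (Suc j))" by blast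
  then have "bump_chain S (\<lambda>j. fst (f j)) (\<lambda>j. snd (f j))"
    using S(2) unfolding P_def Q_def by unfold_locales auto
  then show thesis by (rule that)
qed

section \<open>Sums with disjoint supports\<close>

context
  fixes u :: "nat \<Rightarrow> real \<Rightarrow> real" and c :: "nat \<Rightarrow> real" and B :: real
  assumes int: "\<And>j. integrable lborel (u j)" and nonneg: "\<And>j x. 0 \<le> u j x"
    and bd: "\<And>j. (\<integral>x. u j x \<partial>lborel) \<le> B"
    and disj: "\<forall>x i j. u i x \<noteq> 0 \<longrightarrow> u j x \<noteq> 0 \<longrightarrow> i = j"
    and c_nonneg: "\<And>j. 0 \<le> c j" and c_summable: "summable c"
begin

lemma disjoint_sums_single:
  assumes "\<And>i. i \<noteq> j \<Longrightarrow> u i x = 0"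
  shows "(\<lambda>i. c i * u i x) sums (c j * u j x)"
proof -
  have "(\<lambda>i. c i * u i x) = (\<lambda>i. if i = j then c i * u i x else 0)" using assms by auto
  then show ?thesis using sums_single[of j "\<lambda>i. c i * u i x"] by simp
qed

lemma disjoint_summable: "summable (\<lambda>i. c i * u i x)"
proof (cases "\<exists>j. u j x \<noteq> 0")
  case True
  then show ?thesis using disj disjoint_sums_single by (metis sums_summable)
qed (simp add: summable_zero)

lemma disjoint_sum_integral:
  assumes E: "E \<in> sets lborel"
  shows "set_integrable lborel E (\<lambda>x. \<Sum>j. c j * u j x)"
    and "(\<lambda>j. c j * (LINT x:E|lborel. u j x)) sums (LINT x:E|lborel. (\<Sum>j. c j * u j x))"
proof -
  let ?f = "\<lambda>j x. indicator E x * (c j * u j x)"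
  have fi: "integrable lborel (?f j)" for j
    using integrable_mult_indicator[OF E integrable_mult_right[OF int[of j], of "c j"]] by simp
  have norm: "norm (?f j x) = ?f j x" for j x
    using c_nonneg nonneg by (simp add: abs_mult)
  have ae: "AE x in lborel. summable (\<lambda>j. norm (?f j x))"
    unfolding norm using disjoint_summable by (auto intro: summable_mult)
  have le: "(\<integral>x. ?f j x \<partial>lborel) \<le> c j * B" for j
  proof -
    have "(\<integral>x. ?f j x \<partial>lborel) \<le> (\<integral>x. c j * u j x \<partial>lborel)"
      using fi int c_nonneg nonneg by (intro integral_mono) (auto simp: indicator_def)
    also have "\<dots> \<le> c j * B" using bd c_nonneg by (simp add: mult_left_mono)
    finally show ?thesis .
  qed
  have ge: "0 \<le> (\<integral>x. ?f j x \<partial>lborel)" for j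
    using c_nonneg nonneg by (intro integral_nonneg_AE) auto
  have "summable (\<lambda>j. c j * B)" by (rule summable_mult2[OF c_summable])
  then have "summable (\<lambda>j. \<integral>x. norm (?f j x) \<partial>lborel)"
    unfolding norm by (rule summable_comparison_test'[where N=0]) (simp only: real_norm_def abs_of_nonneg[OF ge] le)
  note S = fi ae this
  have eq: "(\<Sum>j. ?f j x) = indicator E x *\<^sub>R (\<Sum>j. c j * u j x)" for x
    using suminf_mult[OF disjoint_summable[of x], of "indicator E x"] by simp
  show "set_integrable lborel E (\<lambda>x. \<Sum>j. c j * u j x)"
    using integrable_suminf[OF S] unfolding set_integrable_def eq .
  have "(\<integral>x. ?f j x \<partial>lborel) = c j * (LINT x:E|lborel. u j x)" for j
    unfolding set_lebesgue_integral_def by (simp add: mult.left_commute)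
  then show "(\<lambda>j. c j * (LINT x:E|lborel. u j x)) sums (LINT x:E|lborel. (\<Sum>j. c j * u j x))"
    using sums_integral[OF S] unfolding set_lebesgue_integral_def eq by simp
qed

text \<open>A single point of the interval suffices: the lower bounds are dominated by the terms of
  the series that converges there.\<close>

lemma disjoint_summable_minorant:
  assumes "\<And>j. 0 \<le> m j" and m: "\<forall>j. m j \<le> u j x"
  shows "summable (\<lambda>j. c j * m j)"
proof (rule summable_comparison_test'[OF disjoint_summable[of x]])
  fix j :: nat
  assume "0 \<le> j"
  have "c j * m j \<le> c j * u j x" using m c_nonneg by (intro mult_left_mono) auto
  then show "norm (c j * m j) \<le> c j * u j x" using assms(1) c_nonneg by (simp add: abs_mult)
qed

text \<open>The additivity on which both sums rest. It is applied with
  \<open>e j = 2 + 3 * m j\<close> for the weight and with \<open>m j\<close> plus an error term for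
  the logarithms.\<close>

lemma disjoint_sum_excess:
  assumes ab: "a < b" and m: "\<forall>j. \<forall>x\<in>{a..<b}. m j \<le> u j x" and m0: "\<And>j. 0 \<le> m j"
    and le: "\<And>j. (LINT x:{a..<b}|lborel. u j x) \<le> e j * (b - a)" and e: "summable (\<lambda>j. c j * e j)"
  shows "summable (\<lambda>j. c j * m j)"
    and "x \<in> {a..<b} \<Longrightarrow> (\<Sum>j. c j * m j) \<le> (\<Sum>j. c j * u j x)"
    and "(LINT x:{a..<b}|lborel. (\<Sum>j. c j * u j x)) \<le> (\<Sum>j. c j * e j) * (b - a)"
proof -
  show s: "summable (\<lambda>j. c j * m j)"
    by (rule disjoint_summable_minorant[of m a]) (use m m0 ab in auto)
  show "x \<in> {a..<b} \<Longrightarrow> (\<Sum>j. c j * m j) \<le> (\<Sum>j. c j * u j x)"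
    using m c_nonneg by (intro suminf_le s disjoint_summable mult_left_mono) auto
  have "(LINT x:{a..<b}|lborel. (\<Sum>j. c j * u j x)) = (\<Sum>j. c j * (LINT x:{a..<b}|lborel. u j x))"
    using disjoint_sum_integral(2)[of "{a..<b}"] by (simp add: sums_iff)
  also have "\<dots> \<le> (\<Sum>j. c j * e j * (b - a))"
    using disjoint_sum_integral(2)[of "{a..<b}"] le c_nonneg
    by (intro suminf_le summable_mult2 e) (auto simp: sums_iff mult.assoc intro: mult_left_mono)
  also have "\<dots> = (\<Sum>j. c j * e j) * (b - a)" by (rule suminf_mult2[OF e, symmetric])
  finally show "(LINT x:{a..<b}|lborel. (\<Sum>j. c j * u j x)) \<le> (\<Sum>j. c j * e j) * (b - a)" .
qed

end

lemma set_integrable_const_Ico: "set_integrable lborel {a..<b::real} (\<lambda>x. k::real)"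
  by (rule set_integral_Ico_eq_integral) auto

lemma set_integral_const_Ico: "a \<le> b \<Longrightarrow> (LINT x:{a..<b::real}|lborel. (k::real)) = k * (b - a)"
  by (subst set_integral_Ico_eq_integral) auto

text \<open>Replacing the mean by any constant costs at most a factor 2; this allows a lower bound
  of the function to play the role of the mean.\<close>

lemma osc_le:
  fixes f :: "real \<Rightarrow> real"
  assumes ab: "a < b" and f: "set_integrable lborel {a..<b} f"
  shows "osc {a..<b} f \<le> 2 * ((LINT x:{a..<b}|lborel. \<bar>f x - k\<bar>) / (b - a))"
proof -
  define E where "E = avg {a..<b} f"
  let ?I = "LINT x:{a..<b}|lborel. \<bar>f x - k\<bar>"
  have i: "set_integrable lborel {a..<b} (\<lambda>x. f x - y)" for y
    by (intro set_integral_diff(1) f set_integrable_const_Ico)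
  then have i': "set_integrable lborel {a..<b} (\<lambda>x. \<bar>f x - y\<bar>)" for y
    by (rule set_integrable_abs)
  have "E - k = (LINT x:{a..<b}|lborel. f x - k) / (b - a)"
    using ab by (simp add: E_def avg_def set_integral_diff(2)[OF f set_integrable_const_Ico]
      set_integral_const_Ico diff_divide_distrib)
  moreover have "\<bar>LINT x:{a..<b}|lborel. f x - k\<bar> \<le> ?I"
    using set_integral_norm_bound[OF i] by simp
  ultimately have E: "\<bar>E - k\<bar> \<le> ?I / (b - a)"
    using ab by (simp add: abs_divide divide_right_mono)
  have "(LINT x:{a..<b}|lborel. \<bar>f x - E\<bar>) \<le> (LINT x:{a..<b}|lborel. \<bar>f x - k\<bar> + \<bar>E - k\<bar>)"
    by (intro set_integral_mono i' set_integral_add(1) set_integrable_const_Ico) auto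
  also have "\<dots> = ?I + \<bar>E - k\<bar> * (b - a)"
    using ab by (simp add: set_integral_add(2)[OF i' set_integrable_const_Ico] set_integral_const_Ico)
  finally have "osc {a..<b} f \<le> (?I + \<bar>E - k\<bar> * (b - a)) / (b - a)"
    using ab unfolding osc_def E_def[symmetric] by (simp add: avg_def divide_right_mono)
  also have "\<dots> \<le> 2 * (?I / (b - a))" using E ab by (simp add: add_divide_distrib)
  finally show ?thesis .
qed

definition coef :: "nat \<Rightarrow> real" where
  "coef j = (1 / 2) ^ Suc j"

lemma coef_sums: "coef sums 1"
  unfolding coef_def[abs_def] by (rule power_half_series)

lemma coef_pos: "0 < coef j"
  by (simp add: coef_def)

lemma coef_le_1: "coef j \<le> 1"
  unfolding coef_def by (rule power_le_one) auto

lemmas coef_nonneg = less_imp_le[OF coef_pos] and coef_summable = sums_summable[OF coef_sums]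

section \<open>The chain of bumps, their excesses over 1 and their logarithms\<close>

context bump_chain
begin

definition V :: "nat \<Rightarrow> real \<Rightarrow> real" where
  "V j x = bump (p j) (d j) (height j) x - 1"

definition L :: "nat \<Rightarrow> real \<Rightarrow> real" where
  "L j x = ln (1 + V j x)"

lemma height_ge_1: "1 \<le> height j"
  using height_ge(2)[of j] by simp

lemma V_nonneg: "0 \<le> V j x"
  unfolding V_def using bump_ge_1[OF d_pos height_ge_1] by simp

lemma V_le: "1 + V j x \<le> height j"
  unfolding V_def using bump_le[OF d_pos height_ge_1] by simp

lemma V_support: "x \<notin> {p j - d j..p j + d j} \<Longrightarrow> V j x = 0"
  unfolding V_def by (rule bump_excess_support[OF d_pos height_ge_1])

lemma chain_less: "i < j \<Longrightarrow> p j + d j < p i - d i"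
proof (induction j)
  case (Suc j)
  then show ?case using chain[of j] d_pos[of j] by (cases "i = j") (auto simp: less_Suc_eq)
qed simp

lemma intervals_disjoint:
  assumes "x \<in> {p i - d i..p i + d i}" "x \<in> {p j - d j..p j + d j}"
  shows "i = j"
  using chain_less[of i j] chain_less[of j i] assms by (cases i j rule: linorder_cases) auto

lemma interval_subset: "0 < p j - d j" "p j + d j < 1"
proof -
  show "0 < p j - d j" using d_less_p by simp
  show "p j + d j < 1" using chain_less[of 0 j] first d_pos[of 0] by (cases j) auto
qed

lemma d_le_1: "d j \<le> 1"
  using interval_subset[of j] d_less_p[of j] d_pos[of j] by linarith

lemma V_disjoint: "\<forall>x i j. V i x \<noteq> 0 \<longrightarrow> V j x \<noteq> 0 \<longrightarrow> i = j"
  using intervals_disjoint V_support by blast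

lemma V_eq_0: "x \<in> {p j - d j..p j + d j} \<Longrightarrow> i \<noteq> j \<Longrightarrow> V i x = 0"
  using intervals_disjoint V_support by blast

lemma V_integral: "integrable lborel (V j)" "(\<integral>x. V j x \<partial>lborel) \<le> 2"
  unfolding V_def[abs_def]
  using bump_excess_integrable[OF d_pos[of j] height_ge_1[of j], of "p j"] d_le_1[of j] by simp_all

lemma continuous_on_V: "continuous_on E (V j)"
  unfolding V_def[abs_def]
  by (intro continuous_intros continuous_on_bump[OF d_pos height_ge_1])

lemma continuous_on_L: "continuous_on E (L j)"
proof -
  have "1 + V j x \<noteq> 0" for x using V_nonneg[of j x] by simp
  then show ?thesis unfolding L_def[abs_def] by (intro continuous_intros continuous_on_V) auto
qed

lemma L_nonneg: "0 \<le> L j x"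
  unfolding L_def using V_nonneg by simp

lemma L_le_V: "L j x \<le> V j x"
  unfolding L_def using V_nonneg[of j x] by (intro ln_add_one_self_le_self)

lemma L_eq_0: "V j x = 0 \<Longrightarrow> L j x = 0"
  by (simp add: L_def)

lemma L_disjoint: "\<forall>x i j. L i x \<noteq> 0 \<longrightarrow> L j x \<noteq> 0 \<longrightarrow> i = j"
  using V_disjoint L_eq_0 by blast

lemma L_integral: "integrable lborel (L j)" "(\<integral>x. L j x \<partial>lborel) \<le> 2"
proof -
  show i: "integrable lborel (L j)"
  proof (rule Bochner_Integration.integrable_bound[OF V_integral(1)[of j]])
    show "L j \<in> borel_measurable lborel"
      using borel_measurable_continuous_onI[OF continuous_on_L] by simp
  qed (use L_nonneg L_le_V V_nonneg in auto)
  have "(\<integral>x. L j x \<partial>lborel) \<le> (\<integral>x. V j x \<partial>lborel)"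
    by (intro integral_mono i V_integral L_le_V)
  then show "(\<integral>x. L j x \<partial>lborel) \<le> 2" using V_integral(2)[of j] by simp
qed

text \<open>The grid point supplied by \<open>near\<close> lies in the overlap of the flanks. A
  short n-adic interval stays on one side of it and so meets the hypothesis of
  \<open>bump_A1\<close>.\<close>

lemma V_A1:
  assumes "n \<in> S" "J \<in> nadic_all n"
  obtains a b where "J = {a..<b}" "a < b"
    "\<exists>m\<ge>1. (\<forall>x\<in>{a..<b}. m \<le> 1 + V j x) \<and> (LINT x:{a..<b}|lborel. 1 + V j x) \<le> 3 * m * (b - a)"
proof -
  obtain M and i :: int where M: "d j \<le> 1 / real n ^ M" "p j \<le> of_int i / real n ^ M"
        "of_int i / real n ^ M \<le> p j + d j / height j ^ 4"
    using near[OF assms(1)] by blast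
  obtain a b where ab: "J = {a..<b}" "a < b" and
    "d j \<le> b - a \<or> b \<le> of_int i / real n ^ M \<or> of_int i / real n ^ M \<le> a"
    by (rule nadic_cases[OF assms(2) S_ge[OF assms(1)] M(1)])
  then have "d j \<le> b - a \<or> b \<le> p j + d j / height j ^ 4 \<or> p j \<le> a" using M by linarith
  from bump_A1[OF d_pos height_ge_1 ab(2) this] show thesis
    using that[OF ab] by (simp add: V_def)
qed

lemma set_integrable_V: "set_integrable lborel {a..<b} (V j)"
  by (rule set_integral_Ico_eq_integral[OF continuous_on_V])

lemma set_integrable_L: "set_integrable lborel {a..<b} (L j)"
  by (rule set_integral_Ico_eq_integral[OF continuous_on_L])

text \<open>The logarithm lies below its tangent at \<open>m\<close>, so a mean of at most
  \<open>3 * m\<close> becomes a mean of at most \<open>ln m + 3 - 1\<close>, while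
  \<open>ln m\<close> bounds the logarithm from below.\<close>

lemma L_excess:
  assumes "n \<in> S" "{a..<b} \<in> nadic_all n" "a < b"
  shows "\<exists>m\<ge>0. (\<forall>x\<in>{a..<b}. m \<le> L j x) \<and> (LINT x:{a..<b}|lborel. L j x) \<le> (m + 2) * (b - a)"
proof -
  obtain m where m: "m \<ge> 1" "\<forall>x\<in>{a..<b}. m \<le> 1 + V j x"
    "(LINT x:{a..<b}|lborel. 1 + V j x) \<le> 3 * m * (b - a)"
    using V_A1[OF assms(1,2), of j] assms(3) by (metis Ico_eq_Ico)
  have i: "set_integrable lborel {a..<b} (\<lambda>x. 1 + V j x)"
    by (intro set_integral_add(1) set_integrable_V set_integrable_const_Ico)
  have "(LINT x:{a..<b}|lborel. L j x) \<le> (LINT x:{a..<b}|lborel. (ln m - 1) + (1 / m) * (1 + V j x))"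
  proof (intro set_integral_mono set_integrable_L set_integral_add(1) set_integrable_const_Ico
      set_integrable_mult_right i)
    fix x
    have "0 < 1 + V j x" using V_nonneg[of j x] by simp
    then have "L j x = ln m + ln ((1 + V j x) / m)"
      using m(1) by (simp add: L_def ln_div)
    also have "ln ((1 + V j x) / m) \<le> (1 + V j x) / m - 1"
      using m(1) \<open>0 < 1 + V j x\<close> by (intro ln_le_minus_one) auto
    finally show "L j x \<le> (ln m - 1) + (1 / m) * (1 + V j x)" by simp
  qed (rule set_integrable_V)
  also have "\<dots> = (ln m - 1) * (b - a) + (1 / m) * (LINT x:{a..<b}|lborel. 1 + V j x)"
    using assms(3) i by (subst set_integral_add(2))
      (auto intro: set_integrable_const_Ico set_integrable_mult_right simp: set_integral_const_Ico)
  also have "(1 / m) * (LINT x:{a..<b}|lborel. 1 + V j x) \<le> (1 / m) * (3 * m * (b - a))"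
    using m by (intro mult_left_mono) auto
  finally have "(LINT x:{a..<b}|lborel. L j x) \<le> (ln m + 2) * (b - a)"
    using m(1) by (simp add: algebra_simps)
  moreover have "ln m \<le> L j x" if "x \<in> {a..<b}" for x
    unfolding L_def using m that by (intro ln_mono) force+
  ultimately show ?thesis using m(1) by (intro exI[of _ "ln m"]) auto
qed

definition W :: "real \<Rightarrow> real" where
  "W x = 1 + (\<Sum>j. coef j * V j x)"

definition \<phi> :: "real \<Rightarrow> real" where
  "\<phi> x = (\<Sum>j. coef j * L j x)"

lemmas V_sum = V_integral(1) V_nonneg V_integral(2) V_disjoint coef_nonneg coef_summable
lemmas L_sum = L_integral(1) L_nonneg L_integral(2) L_disjoint coef_nonneg coef_summable

lemma W_eq:
  assumes "x \<in> {p j - d j..p j + d j}"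
  shows "W x = 1 + coef j * V j x"
  unfolding W_def using disjoint_sums_single[OF V_sum, where j=j and x=x] V_eq_0[OF assms] by (simp add: sums_iff)

lemma \<phi>_eq:
  assumes "x \<in> {p j - d j..p j + d j}"
  shows "\<phi> x = coef j * L j x"
  unfolding \<phi>_def using disjoint_sums_single[OF L_sum, where j=j and x=x] V_eq_0[OF assms] L_eq_0
  by (simp add: sums_iff)

lemma W_ge_1: "1 \<le> W x"
  unfolding W_def using suminf_nonneg[OF disjoint_summable[OF V_sum, where x=x]] V_nonneg coef_nonneg by simp

lemma \<phi>_nonneg: "0 \<le> \<phi> x"
  unfolding \<phi>_def using suminf_nonneg[OF disjoint_summable[OF L_sum, where x=x]] L_nonneg coef_nonneg by simp

lemma \<phi>_integrable: "integrable lborel \<phi>"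
  using disjoint_sum_integral(1)[OF L_sum, where E=UNIV] by (simp add: \<phi>_def[abs_def] set_integrable_def)

lemma W_minus_1_integrable: "integrable lborel (\<lambda>x. W x - 1)"
  using disjoint_sum_integral(1)[OF V_sum, where E=UNIV] by (simp add: W_def[abs_def] set_integrable_def)

lemma W_set_integrable: "E \<in> sets lborel \<Longrightarrow> emeasure lborel E < \<infinity> \<Longrightarrow> set_integrable lborel E W"
  using set_integral_add(1)[of lborel E "\<lambda>x. 1" "\<lambda>x. W x - 1"]
    integrable_mult_indicator[OF _ W_minus_1_integrable]
  by (simp add: set_integrable_def)

lemma W_A1:
  assumes "n \<in> S" "{a..<b} \<in> nadic_all n" "a < b"
  shows "\<exists>m\<ge>1. (\<forall>x\<in>{a..<b}. m \<le> W x) \<and> (LINT x:{a..<b}|lborel. W x) \<le> 3 * m * (b - a)"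
proof -
  have "\<exists>m\<ge>1. (\<forall>x\<in>{a..<b}. m \<le> 1 + V j x) \<and> (LINT x:{a..<b}|lborel. 1 + V j x) \<le> 3 * m * (b - a)" for j
    using V_A1[OF assms(1,2), of j] assms(3) by (metis Ico_eq_Ico)
  then obtain m where m: "\<And>j. m j \<ge> 1" "\<And>j. \<forall>x\<in>{a..<b}. m j \<le> 1 + V j x"
    "\<And>j. (LINT x:{a..<b}|lborel. 1 + V j x) \<le> 3 * m j * (b - a)"
    by metis
  define k where "k j = m j - 1" for j
  have k: "\<And>j. 0 \<le> k j" "\<forall>j. \<forall>x\<in>{a..<b}. k j \<le> V j x"
    using m(1,2) by (auto simp: k_def algebra_simps)
  \<comment> \<open>Since \<open>3 * m j - 1 = 2 + 3 * k j\<close> and the coefficients sum to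
    exactly 1, adding the constant 1 of \<open>W\<close> restores the factor 3.\<close>
  have le: "(LINT x:{a..<b}|lborel. V j x) \<le> (2 + 3 * k j) * (b - a)" for j
    using m(3)[of j] assms(3)
    by (simp add: set_integral_add(2)[OF set_integrable_const_Ico set_integrable_V]
        set_integral_const_Ico k_def algebra_simps)
  have s: "summable (\<lambda>j. coef j * k j)"
    by (rule disjoint_summable_minorant[OF V_sum, where x=a]) (use k assms(3) in auto)
  have e: "(\<lambda>j. coef j * (2 + 3 * k j)) sums (2 + 3 * (\<Sum>j. coef j * k j))"
    using sums_add[OF sums_mult[OF coef_sums, of 2] sums_mult[OF summable_sums[OF s], of 3]]
    by (simp add: algebra_simps)
  let ?M = "1 + (\<Sum>j. coef j * k j)"
  note ex = disjoint_sum_excess[OF V_sum assms(3) k(2) k(1) le sums_summable[OF e]]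
  have "(LINT x:{a..<b}|lborel. W x) = (b - a) + (LINT x:{a..<b}|lborel. (\<Sum>j. coef j * V j x))"
    unfolding W_def using assms(3)
    by (subst set_integral_add(2)[OF set_integrable_const_Ico disjoint_sum_integral(1)[OF V_sum]])
       (auto simp: set_integral_const_Ico)
  also have "\<dots> \<le> 3 * ?M * (b - a)"
    using ex(3)[folded sums_unique[OF e]] by (simp add: algebra_simps)
  finally have "(LINT x:{a..<b}|lborel. W x) \<le> 3 * ?M * (b - a)" .
  moreover have "1 \<le> ?M" using suminf_nonneg[OF s] k coef_nonneg by simp
  ultimately show ?thesis using ex(2) unfolding W_def by (intro exI[of _ ?M]) auto
qed

text \<open>The sum of the weighted lower bounds lies below \<open>\<phi>\<close> on the whole
  interval, so the absolute value disappears and the oscillation about this constant is a difference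
  of means.\<close>

lemma osc_\<phi>_le:
  assumes ab: "a < b" and m: "\<And>j. 0 \<le> m j" "\<forall>j. \<forall>x\<in>{a..<b}. m j \<le> L j x"
    and le: "\<And>j. (LINT x:{a..<b}|lborel. L j x) \<le> (m j + e j) * (b - a)"
    and e: "summable (\<lambda>j. coef j * e j)"
  shows "osc {a..<b} \<phi> \<le> 2 * (\<Sum>j. coef j * e j)"
proof -
  have s: "summable (\<lambda>j. coef j * m j)"
    by (rule disjoint_summable_minorant[OF L_sum, where x=a]) (use m ab in auto)
  have e': "(\<lambda>j. coef j * (m j + e j)) sums ((\<Sum>j. coef j * m j) + (\<Sum>j. coef j * e j))"
    using sums_add[OF summable_sums[OF s] summable_sums[OF e]] by (simp add: algebra_simps)
  let ?M = "\<Sum>j. coef j * m j"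
  note ex = disjoint_sum_excess[OF L_sum ab m(2) m(1) le sums_summable[OF e']]
  have i: "set_integrable lborel {a..<b} \<phi>"
    using disjoint_sum_integral(1)[OF L_sum] unfolding \<phi>_def[abs_def] by simp
  have "(LINT x:{a..<b}|lborel. \<bar>\<phi> x - ?M\<bar>) = (LINT x:{a..<b}|lborel. \<phi> x - ?M)"
    using ex(2) by (intro set_lebesgue_integral_cong) (auto simp: \<phi>_def)
  also have "\<dots> = (LINT x:{a..<b}|lborel. \<phi> x) - ?M * (b - a)"
    using ab by (simp add: set_integral_diff(2)[OF i set_integrable_const_Ico] set_integral_const_Ico)
  also have "\<dots> \<le> (\<Sum>j. coef j * e j) * (b - a)"
    using ex(3)[folded sums_unique[OF e']] by (simp add: \<phi>_def algebra_simps)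
  finally have "(LINT x:{a..<b}|lborel. \<bar>\<phi> x - ?M\<bar>) / (b - a) \<le> (\<Sum>j. coef j * e j)"
    using ab by (simp add: divide_le_eq)
  with osc_le[OF ab i, of ?M] show ?thesis by simp
qed

end

section \<open>Weights and bounded mean oscillation\<close>

lemma nadic_subset_all: "J \<in> nadic n D \<Longrightarrow> J \<in> nadic_all n"
  by (cases D) auto

lemma nadic_Ico:
  assumes "J \<in> nadic n D" "2 \<le> n"
  obtains a b where "J = {a..<b}" "a < b"
  using nadic_cases[OF nadic_subset_all[OF assms(1)] assms(2), of 0 0] by auto

lemma set_integrable_bounded:
  fixes f :: "real \<Rightarrow> real"
  assumes "f \<in> borel_measurable lborel" "E \<in> sets lborel" "emeasure lborel E < \<infinity>"
    "\<And>x. \<bar>f x\<bar> \<le> B"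
  shows "set_integrable lborel E f"
  unfolding set_integrable_def
proof (rule Bochner_Integration.integrable_bound)
  show "integrable lborel (\<lambda>x. indicator E x *\<^sub>R B)"
    using assms by (intro integrable_scaleR_left integrable_real_indicator) auto
  show "AE x in lborel. norm (indicator E x *\<^sub>R f x) \<le> norm (indicator E x *\<^sub>R B)"
  proof (intro AE_I2)
    show "norm (indicator E x *\<^sub>R f x) \<le> norm (indicator E x *\<^sub>R B)" for x
      using assms(4)[of x] by (simp add: indicator_def)
  qed
qed (use assms in auto)

lemma set_integral_ge_two_steps:
  fixes g :: "real \<Rightarrow> real"
  assumes g: "set_integrable lborel {a..b} g" "\<And>x. x \<in> {a..b} \<Longrightarrow> 0 \<le> g x"
    and sub: "a \<le> x1" "x1 \<le> y1" "y1 < x2" "x2 \<le> y2" "y2 \<le> b"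
    and v: "\<And>x. x \<in> {x1..y1} \<Longrightarrow> v1 \<le> g x" "\<And>x. x \<in> {x2..y2} \<Longrightarrow> v2 \<le> g x"
  shows "v1 * (y1 - x1) + v2 * (y2 - x2) \<le> (LINT x:{a..b}|lborel. g x)"
proof -
  have i: "integrable lborel (\<lambda>x. indicator {x1..y1} x *\<^sub>R v1 + indicator {x2..y2} x *\<^sub>R v2)"
    by (intro Bochner_Integration.integrable_add integrable_scaleR_left integrable_real_indicator)
      (auto simp: emeasure_lborel_Icc_eq)
  have "v1 * (y1 - x1) + v2 * (y2 - x2) = (\<integral>x. indicator {x1..y1} x *\<^sub>R v1 + indicator {x2..y2} x *\<^sub>R v2 \<partial>lborel)"
    using sub by (subst Bochner_Integration.integral_add)
      (auto intro!: integrable_scaleR_left integrable_real_indicator)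
  also have "\<dots> \<le> (LINT x:{a..b}|lborel. g x)"
    unfolding set_lebesgue_integral_def
  proof (rule integral_mono[OF i])
    show "integrable lborel (\<lambda>x. indicator {a..b} x *\<^sub>R g x)"
      using g(1) by (simp add: set_integrable_def)
    show "indicator {x1..y1} x *\<^sub>R v1 + indicator {x2..y2} x *\<^sub>R v2 \<le> indicator {a..b} x *\<^sub>R g x" for x
      using g(2)[of x] v(1)[of x] v(2)[of x] sub by (auto simp: indicator_def)
  qed
  finally show ?thesis .
qed

lemma coef_height: "2 ^ Suc j \<le> coef j * height j"
proof -
  have "coef j * 4 ^ Suc j = ((1 / 2) * 4) ^ Suc j" unfolding coef_def power_mult_distrib ..
  then have "coef j * 4 ^ Suc j = 2 ^ Suc j" by simp
  moreover have "coef j * 4 ^ Suc j \<le> coef j * height j"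
    by (intro mult_left_mono height_ge coef_nonneg)
  ultimately show ?thesis by simp
qed

lemma coef_ln_height: "coef j * ln (height j) = 2 ^ Suc j"
proof -
  have "coef j * ln (height j) = coef j * 4 ^ Suc j" by (simp add: height_def)
  also have "\<dots> = ((1 / 2) * 4) ^ Suc j" unfolding coef_def power_mult_distrib ..
  finally show ?thesis by simp
qed

lemma two_power_unbounded:
  assumes "0 < \<theta>" "\<And>j. \<theta> * 2 ^ Suc j \<le> (B::real)"
  shows False
proof -
  obtain n where "B / \<theta> < 2 ^ n" using real_arch_pow[of 2 "B / \<theta>"] by auto
  also have "(2::real) ^ n \<le> 2 ^ Suc n" by simp
  finally have "B < \<theta> * 2 ^ Suc n" using assms(1) by (simp add: field_simps)
  with assms(2)[of n] show False by simp
qed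

section \<open>Membership of \<open>W\<close> and its roots in the n-adic weight classes\<close>

context bump_chain
begin

lemma W_measurable: "W \<in> borel_measurable lborel"
proof -
  have "(\<lambda>x. (W x - 1) + 1) \<in> borel_measurable lborel"
    using borel_measurable_integrable[OF W_minus_1_integrable] by (intro borel_measurable_add) auto
  then show ?thesis by simp
qed

lemma locint_W: "locint D W"
  by (cases D) (auto intro!: W_set_integrable simp: emeasure_lborel_Icc_eq)

lemma W_powr_neg:
  assumes "s \<le> 0" "E \<in> sets lborel" "emeasure lborel E < \<infinity>"
  shows "set_integrable lborel E (\<lambda>x. W x powr s)"
proof (rule set_integrable_bounded)
  show "(\<lambda>x. W x powr s) \<in> borel_measurable lborel" using W_measurable by measurable
  show "\<bar>W x powr s\<bar> \<le> 1" for x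
    using powr_mono2'[OF assms(1), of 1 "W x"] W_ge_1[of x] by simp
qed (use assms in auto)

text \<open>A_1 implies A_r: from \<open>W \<ge> m\<close> the second factor is at most
  \<open>1 / m\<close>, which cancels the bound \<open>3 * m\<close> on the mean.\<close>

lemma W_in_An:
  assumes n: "n \<in> S" and r: "1 < r"
  shows "W \<in> An n r D"
proof -
  let ?s = "- 1 / (r - 1)"
  have s: "?s \<le> 0" using r by simp
  have "avg J W * avg J (\<lambda>x. W x powr ?s) powr (r - 1) \<le> 3" if J: "J \<in> nadic n D" for J
  proof -
    obtain a b where ab: "J = {a..<b}" "a < b" by (rule nadic_Ico[OF J S_ge[OF n]])
    obtain m where m: "m \<ge> 1" "\<forall>x\<in>{a..<b}. m \<le> W x" "(LINT x:{a..<b}|lborel. W x) \<le> 3 * m * (b - a)"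
      using W_A1[OF n _ ab(2)] nadic_subset_all[OF J] ab(1) by auto
    have 1: "avg J W \<le> 3 * m" using ab m(3) by (simp add: avg_def divide_le_eq)
    have 0: "0 \<le> avg J (\<lambda>x. W x powr ?s)"
      using ab by (auto simp: avg_def set_lebesgue_integral_def intro!: divide_nonneg_nonneg integral_nonneg_AE)
    have "(LINT x:{a..<b}|lborel. W x powr ?s) \<le> (LINT x:{a..<b}|lborel. m powr ?s)"
      using m s ab by (intro set_integral_mono W_powr_neg set_integrable_const_Ico powr_mono2') auto
    then have "avg J (\<lambda>x. W x powr ?s) \<le> m powr ?s"
      using ab by (simp add: avg_def divide_le_eq set_integral_const_Ico)
    then have "avg J (\<lambda>x. W x powr ?s) powr (r - 1) \<le> (m powr ?s) powr (r - 1)"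
      using 0 r by (intro powr_mono2) auto
    also have "\<dots> = m powr (- 1)" using r unfolding powr_powr by simp
    also have "\<dots> = 1 / m" using m(1) by (simp add: powr_minus_divide)
    finally have "avg J W * avg J (\<lambda>x. W x powr ?s) powr (r - 1) \<le> (3 * m) * (1 / m)"
      using 1 m(1) by (intro mult_mono) auto
    then show ?thesis using m(1) by simp
  qed
  moreover have "AE x in lborel. x \<in> carrier_set D \<longrightarrow> 0 < W x"
    using W_ge_1 by (intro AE_I2) (smt (verit))
  moreover have "set_integrable lborel J (\<lambda>x. W x powr ?s)" if J: "J \<in> nadic n D" for J
    by (rule nadic_Ico[OF J S_ge[OF n]]) (use s in \<open>auto intro!: W_powr_neg\<close>)
  moreover have "weight D W"
    unfolding weight_def using locint_W W_ge_1 by (smt (verit))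
  ultimately show ?thesis unfolding An_def A_cond_def by blast
qed

lemma set_integrable_root_W:
  assumes "1 < r" "E \<in> sets lborel" "emeasure lborel E < \<infinity>"
  shows "set_integrable lborel E (\<lambda>x. W x powr (1 / r))"
  unfolding set_integrable_def
proof (rule Bochner_Integration.integrable_bound)
  show "integrable lborel (\<lambda>x. indicator E x *\<^sub>R W x)"
    using W_set_integrable[OF assms(2,3)] by (simp add: set_integrable_def)
  show "AE x in lborel. norm (indicator E x *\<^sub>R W x powr (1 / r)) \<le> norm (indicator E x *\<^sub>R W x)"
  proof (intro AE_I2)
    fix x
    have "W x powr (1 / r) \<le> W x powr 1" using assms(1) W_ge_1[of x] by (intro powr_mono) auto
    then show "norm (indicator E x *\<^sub>R W x powr (1 / r)) \<le> norm (indicator E x *\<^sub>R W x)"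
      using W_ge_1[of x] by (simp add: indicator_def)
  qed
qed (use W_measurable assms in measurable)

lemma root_W_powr: "1 < r \<Longrightarrow> (W x powr (1 / r)) powr r = W x"
  using W_ge_1[of x] by (simp add: powr_powr)

lemma root_W_bounds:
  assumes n: "n \<in> S" and r: "1 < r" and J: "{a..<b} \<in> nadic_all n" "a < b"
  obtains k where "0 < k" "\<And>x. x \<in> {a..<b} \<Longrightarrow> k \<le> W x powr (1 / r)"
    "(LINT x:{a..<b}|lborel. W x powr (1 / r)) \<le> 4 * k * (b - a)"
    "(LINT x:{a..<b}|lborel. W x) \<le> 3 * k powr r * (b - a)"
proof -
  obtain m where m: "m \<ge> 1" "\<forall>x\<in>{a..<b}. m \<le> W x" "(LINT x:{a..<b}|lborel. W x) \<le> 3 * m * (b - a)"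
    using W_A1[OF n J] by auto
  let ?k = "m powr (1 / r)"
  have k: "0 < ?k" "?k powr r = m" using m(1) r by (auto simp: powr_powr)
  have W: "set_integrable lborel {a..<b} W" using J(2) by (intro W_set_integrable) auto
  have "(LINT x:{a..<b}|lborel. W x powr (1 / r)) \<le> (LINT x:{a..<b}|lborel. ?k + (?k / m) * W x)"
  proof (intro set_integral_mono set_integrable_root_W r set_integral_add(1) set_integrable_const_Ico
      set_integrable_mult_right W)
    fix x
    have y: "0 \<le> W x / m" using W_ge_1[of x] m(1) by simp
    \<comment> \<open>With this elementary inequality the mean of the root is at most
      \<open>?k * (1 + 3)\<close>, so the root inherits an A_1 bound with constant 4.\<close>
    have "(W x / m) powr (1 / r) \<le> 1 + W x / m"
    proof -
      have "(W x / m) powr (1 / r) \<le> (1 + W x / m) powr (1 / r)" using y r by (intro powr_mono2) auto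
      also have "\<dots> \<le> (1 + W x / m) powr 1" using y r by (intro powr_mono) auto
      finally show ?thesis using y by simp
    qed
    then have "?k * (W x / m) powr (1 / r) \<le> ?k * (1 + W x / m)" using k by (intro mult_left_mono) auto
    moreover have "W x powr (1 / r) = ?k * (W x / m) powr (1 / r)"
      using y m(1) by (simp flip: powr_mult)
    ultimately show "W x powr (1 / r) \<le> ?k + (?k / m) * W x" by (simp add: distrib_left)
  qed (use J(2) in auto)
  also have "\<dots> = ?k * (b - a) + (?k / m) * (LINT x:{a..<b}|lborel. W x)"
    using J(2) by (subst set_integral_add(2)[OF set_integrable_const_Ico set_integrable_mult_right[OF W]])
      (auto simp: set_integral_const_Ico)
  also have "(?k / m) * (LINT x:{a..<b}|lborel. W x) \<le> (?k / m) * (3 * m * (b - a))"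
    using k m by (intro mult_left_mono) auto
  finally have "(LINT x:{a..<b}|lborel. W x powr (1 / r)) \<le> 4 * ?k * (b - a)"
    using m(1) by (simp add: algebra_simps)
  moreover have "?k \<le> W x powr (1 / r)" if "x \<in> {a..<b}" for x
    using m r that by (intro powr_mono2) auto
  ultimately show thesis using that[of ?k] k m(3) by simp
qed

lemma root_W_in_RHn:
  assumes n: "n \<in> S" and r: "1 < r"
  shows "(\<lambda>x. W x powr (1 / r)) \<in> RHn n r D" (is "?w \<in> _")
proof -
  have n2: "2 \<le> n" by (rule S_ge[OF n])
  have locint: "locint D ?w" by (cases D) (auto intro!: set_integrable_root_W r simp: emeasure_lborel_Icc_eq)
  have RH: "avg J (\<lambda>x. ?w x powr r) powr (1 / r) \<le> 3 powr (1 / r) * avg J ?w" if J: "J \<in> nadic n D" for J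
  proof -
    obtain a b where ab: "J = {a..<b}" "a < b" by (rule nadic_Ico[OF J n2])
    obtain k where k: "0 < k" "\<And>x. x \<in> {a..<b} \<Longrightarrow> k \<le> ?w x"
      "(LINT x:{a..<b}|lborel. W x) \<le> 3 * k powr r * (b - a)"
      by (rule root_W_bounds[OF n r _ ab(2)]) (use nadic_subset_all[OF J] ab(1) in auto)
    have "0 \<le> (LINT x:{a..<b}|lborel. W x)"
      using W_ge_1 by (auto simp: set_lebesgue_integral_def intro!: integral_nonneg_AE AE_I2)
        (smt (verit) indicator_pos_le mult_nonneg_nonneg)
    then have "0 \<le> avg J W" "avg J W \<le> 3 * k powr r"
      using ab k(3) by (auto simp: avg_def divide_le_eq)
    then have "avg J W powr (1 / r) \<le> (3 * k powr r) powr (1 / r)"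
      using r by (intro powr_mono2) auto
    also have "\<dots> = 3 powr (1 / r) * k" using k r by (simp add: powr_mult powr_powr)
    also have "\<dots> \<le> 3 powr (1 / r) * avg J ?w"
    proof -
      have "(LINT x:{a..<b}|lborel. k) \<le> (LINT x:{a..<b}|lborel. ?w x)"
        using k(2) ab by (intro set_integral_mono set_integrable_root_W r set_integrable_const_Ico) auto
      then have "k \<le> avg J ?w"
        using ab by (simp add: avg_def le_divide_eq set_integral_const_Ico)
      then show ?thesis by (intro mult_left_mono) auto
    qed
    finally show ?thesis using root_W_powr[OF r] by simp
  qed
  \<comment> \<open>The lower bound \<open>k\<close> of the parent holds on \<open>J2\<close> too,
    and \<open>J2\<close> has the fraction \<open>1 / n\<close> of the parent's length; the integral
    over \<open>J1\<close> is estimated by that over the whole parent.\<close>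
  have doubling: "(LINT x:J1|lborel. ?w x) \<le> (4 * real n) * (LINT x:J2|lborel. ?w x)"
    if J: "J \<in> nadic n D" and J1: "J1 \<in> nchildren n J" and J2: "J2 \<in> nchildren n J" for J J1 J2
  proof -
    obtain a b where ab: "J = {a..<b}" "a < b" by (rule nadic_Ico[OF J n2])
    obtain k where k: "0 < k" "\<And>x. x \<in> {a..<b} \<Longrightarrow> k \<le> ?w x"
      "(LINT x:{a..<b}|lborel. ?w x) \<le> 4 * k * (b - a)"
      by (rule root_W_bounds[OF n r _ ab(2)]) (use nadic_subset_all[OF J] ab(1) in auto)
    obtain a1 b1 where ab1: "J1 = {a1..<b1}" "a1 < b1"
      using nadic_cases[of J1 n 0 0] n2 J1 by (auto simp: nchildren_def)
    obtain a2 b2 where ab2: "J2 = {a2..<b2}" "a2 < b2"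
      using nadic_cases[of J2 n 0 0] n2 J2 by (auto simp: nchildren_def)
    have sub: "J1 \<subseteq> {a..<b}" "J2 \<subseteq> {a..<b}" and len: "b2 - a2 = (b - a) / real n"
      using J1 J2 ab ab1 ab2 by (auto simp: nchildren_def)
    have "(LINT x:J1|lborel. ?w x) \<le> (LINT x:{a..<b}|lborel. ?w x)"
      unfolding set_lebesgue_integral_def
    proof (rule integral_mono)
      show "integrable lborel (\<lambda>x. indicator J1 x *\<^sub>R ?w x)" "integrable lborel (\<lambda>x. indicator {a..<b} x *\<^sub>R ?w x)"
        using set_integrable_root_W[OF r, of J1] set_integrable_root_W[OF r, of "{a..<b}"] ab ab1
        by (auto simp: set_integrable_def)
      show "indicator J1 x *\<^sub>R ?w x \<le> indicator {a..<b} x *\<^sub>R ?w x" for x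
        using sub by (auto simp: indicator_def)
    qed
    also have "\<dots> \<le> (4 * real n) * (k * (b2 - a2))" using k(3) len n2 by (simp add: mult_ac)
    also have "k * (b2 - a2) = (LINT x:J2|lborel. k)" using ab2 by (simp add: set_integral_const_Ico)
    also have "(4 * real n) * (LINT x:J2|lborel. k) \<le> (4 * real n) * (LINT x:J2|lborel. ?w x)"
      using k(2) sub ab2 unfolding ab2(1)
      by (intro mult_left_mono set_integral_mono set_integrable_root_W r set_integrable_const_Ico) auto
    finally show ?thesis .
  qed
  have "set_integrable lborel J (\<lambda>x. ?w x powr r)" if J: "J \<in> nadic n D" for J
    unfolding root_W_powr[OF r]
    by (rule nadic_Ico[OF J n2]) (auto intro!: W_set_integrable)
  then have "RH_cond r (nadic n D) ?w" unfolding RH_cond_def using RH by blast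
  moreover have "ndoubling n D ?w"
    unfolding ndoubling_def using doubling n2 by (intro exI[of _ "4 * real n"]) auto
  moreover have "weight D ?w" unfolding weight_def using locint by simp
  ultimately show ?thesis unfolding RHn_def by blast
qed

text \<open>The scale that separates the two flanks: the plateau reaches at least to
  \<open>p j + eta j\<close>, and the bump is back to 1 at \<open>p j - eta j\<close>.\<close>

definition eta :: "nat \<Rightarrow> real" where
  "eta j = d j / (height j)\<^sup>2"

lemma eta_pos: "0 < eta j"
  unfolding eta_def by (rule bump_scales[OF d_pos height_ge_1])

lemma eta_le: "\<kappa> \<le> (height j)\<^sup>2 \<Longrightarrow> \<kappa> * eta j \<le> d j"
  using d_pos[of j] height_ge_1[of j] by (simp add: eta_def divide_le_eq mult.commute mult_left_mono)

lemma eta_le_d: "eta j \<le> d j"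
  unfolding eta_def by (rule bump_scales[OF d_pos height_ge_1])

lemma two_le_height_square: "2 \<le> (height j)\<^sup>2"
  using height_ge(2)[of j] mult_mono[of 2 "height j" 1 "height j"] by (simp add: power2_eq_square)

lemma V_left: "x \<le> p j - eta j \<Longrightarrow> V j x = 0"
  unfolding V_def eta_def by (simp add: bump_eq_1_left[OF d_pos height_ge_1])

lemma V_top: "p j \<le> x \<Longrightarrow> x \<le> p j + eta j \<Longrightarrow> 1 + V j x = height j"
  unfolding V_def eta_def by (simp add: bump_eq_top[OF d_pos height_ge_1])

text \<open>On \<open>I \<kappa> j\<close> the weight \<open>W\<close> is 1 except on a right part of relative size about \<open>1 / \<kappa>\<close>, where it
  is huge; \<open>\<kappa> = 2\<close> refutes the \<open>A\<^sub>r\<close> and \<open>BMO\<close> conditions, \<open>\<kappa> = height j powr (1 / r)\<close> the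
  reverse Hoelder condition.\<close>

definition I :: "real \<Rightarrow> nat \<Rightarrow> real set" where
  "I \<kappa> j = {p j - \<kappa> * eta j..p j + eta j}"

context
  fixes \<kappa> :: real and j :: nat
  assumes \<kappa>: "1 < \<kappa>" "\<kappa> \<le> (height j)\<^sup>2"
begin

lemma I_subset: "I \<kappa> j \<subseteq> {p j - d j..p j + d j}"
  unfolding I_def using eta_le[OF \<kappa>(2)] eta_le_d[of j] by auto

lemma I_interval: "I \<kappa> j \<in> intervals D"
proof -
  have "0 < \<kappa> * eta j" using \<kappa> eta_pos by simp
  then have "p j - \<kappa> * eta j < p j + eta j" using eta_pos[of j] by linarith
  moreover have "0 \<le> p j - \<kappa> * eta j" "p j + eta j \<le> 1"
    using interval_subset[of j] eta_le[OF \<kappa>(2)] eta_le_d[of j] by linarith+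
  ultimately show ?thesis unfolding I_def by (cases D) auto
qed

lemma measure_I: "measure lborel (I \<kappa> j) = (\<kappa> + 1) * eta j"
proof -
  have "0 < \<kappa> * eta j" using \<kappa> eta_pos by simp
  then have "p j - \<kappa> * eta j \<le> p j + eta j" using eta_pos[of j] by linarith
  then show ?thesis unfolding I_def by (simp add: algebra_simps)
qed

text \<open>In units of \<open>eta j\<close>, the flat left part has length
  \<open>\<kappa> - 1\<close>, the plateau has length 1, and the climbing flank between them, again
  of length 1, is estimated by 0.\<close>

lemma I_integral_ge:
  assumes g: "set_integrable lborel (I \<kappa> j) g" "\<And>x. x \<in> I \<kappa> j \<Longrightarrow> 0 \<le> g x"
    and v: "\<And>x. x \<in> I \<kappa> j \<Longrightarrow> x \<le> p j - eta j \<Longrightarrow> v1 \<le> g x"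
      "\<And>x. x \<in> I \<kappa> j \<Longrightarrow> p j \<le> x \<Longrightarrow> v2 \<le> g x"
  shows "(v1 * (\<kappa> - 1) + v2) / (\<kappa> + 1) \<le> avg (I \<kappa> j) g"
proof -
  have k: "eta j < \<kappa> * eta j" "0 < eta j" using \<kappa> eta_pos[of j] by auto
  have "v1 * ((p j - eta j) - (p j - \<kappa> * eta j)) + v2 * ((p j + eta j) - p j) \<le> (LINT x:I \<kappa> j|lborel. g x)"
    unfolding I_def
    by (rule set_integral_ge_two_steps) (use g v k in \<open>auto simp: I_def\<close>)
  then have "(v1 * (\<kappa> - 1) + v2) * eta j / ((\<kappa> + 1) * eta j) \<le> (LINT x:I \<kappa> j|lborel. g x) / ((\<kappa> + 1) * eta j)"
    using k \<kappa> by (intro divide_right_mono) (auto simp: algebra_simps)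
  then show ?thesis using k unfolding avg_def measure_I by simp
qed

lemma W_on_I:
  assumes "x \<in> I \<kappa> j"
  shows "x \<le> p j - eta j \<Longrightarrow> W x = 1" "p j \<le> x \<Longrightarrow> coef j * height j \<le> W x" "W x \<le> height j"
proof -
  have W: "W x = 1 + coef j * V j x" using assms I_subset by (intro W_eq) auto
  show "x \<le> p j - eta j \<Longrightarrow> W x = 1" using W V_left by simp
  show "coef j * height j \<le> W x" if "p j \<le> x"
  proof -
    have "V j x = height j - 1" using V_top[OF that] assms by (simp add: I_def)
    then have "W x = coef j * height j + (1 - coef j)" unfolding W by (simp only: right_diff_distrib)
    then show ?thesis using coef_le_1[of j] by simp
  qed
  have "coef j * V j x \<le> 1 * V j x" by (intro mult_right_mono coef_le_1 V_nonneg)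
  then show "W x \<le> height j" using W V_le[of j x] by simp
qed

lemma I_sets: "I \<kappa> j \<in> sets lborel" "emeasure lborel (I \<kappa> j) < \<infinity>"
  unfolding I_def by (auto simp: emeasure_lborel_Icc_eq)

end

text \<open>On the right third of \<open>I 2 j\<close> the weight is at least
  \<open>2 ^ Suc j\<close>, and on the left third it is 1, which keeps the second factor away from
  0.\<close>

lemma W_not_in_A:
  assumes r: "1 < r"
  shows "W \<notin> A r D"
proof
  let ?s = "- 1 / (r - 1)"
  assume "W \<in> A r D"
  then obtain C where C: "\<And>I. I \<in> intervals D \<Longrightarrow> avg I W * avg I (\<lambda>x. W x powr ?s) powr (r - 1) \<le> C"
    unfolding A_def A_cond_def by blast
  have "((1 / 3) * (1 / 3) powr (r - 1)) * 2 ^ Suc j \<le> C" for j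
  proof -
    have k: "(1::real) < 2" "2 \<le> (height j)\<^sup>2" using two_le_height_square by auto
    note sets = I_sets[OF k]
    have "(0 * (2 - 1) + coef j * height j) / (2 + 1) \<le> avg (I 2 j) W"
      using W_on_I[OF k] W_ge_1 by (intro I_integral_ge[OF k] W_set_integrable sets) (auto intro: order_trans[OF zero_le_one])
    then have 1: "2 ^ Suc j / 3 \<le> avg (I 2 j) W" using coef_height[of j] by simp
    have "(1 * (2 - 1) + 0) / (2 + 1) \<le> avg (I 2 j) (\<lambda>x. W x powr ?s)"
      using r W_on_I[OF k] by (intro I_integral_ge[OF k] W_powr_neg sets) auto
    then have "(1 / 3) powr (r - 1) \<le> avg (I 2 j) (\<lambda>x. W x powr ?s) powr (r - 1)"
      using r by (intro powr_mono2) auto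
    then have "(2 ^ Suc j / 3) * (1 / 3) powr (r - 1) \<le> avg (I 2 j) W * avg (I 2 j) (\<lambda>x. W x powr ?s) powr (r - 1)"
      using 1 by (intro mult_mono) (auto intro: order_trans[OF _ 1])
    also have "\<dots> \<le> C" by (rule C[OF I_interval[OF k]])
    finally show ?thesis by (simp add: mult_ac)
  qed
  then show False by (rule two_power_unbounded[rotated]) simp
qed

text \<open>With \<open>\<kappa> = height j powr (1 / r)\<close> the high part contributes only a
  bounded amount to the mean of the root, whereas the mean of \<open>W\<close> is at least half of
  \<open>coef j * height j powr (1 - 1 / r)\<close>.\<close>

lemma root_W_not_in_RH:
  assumes r: "1 < r"
  shows "(\<lambda>x. W x powr (1 / r)) \<notin> RH r D" (is "?w \<notin> _")
proof
  assume "?w \<in> RH r D"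
  then obtain C where "\<And>I. I \<in> intervals D \<Longrightarrow> avg I (\<lambda>x. ?w x powr r) powr (1 / r) \<le> C * avg I ?w"
    unfolding RH_def RH_cond_def by blast
  then have C: "\<And>I. I \<in> intervals D \<Longrightarrow> avg I W powr (1 / r) \<le> C * avg I ?w"
    unfolding root_W_powr[OF r] .
  define \<theta> where "\<theta> = 1 - 1 / r"
  have \<theta>: "0 < \<theta>" using r by (simp add: \<theta>_def)
  have "\<theta> / 2 * 2 ^ Suc j \<le> (3 * \<bar>C\<bar>) powr r" for j
  proof -
    define \<kappa> where "\<kappa> = height j powr (1 / r)"
    have h1: "1 < height j" using height_ge(2)[of j] by simp
    have "height j powr (1 / r) \<le> height j powr 2" using h1 r by (intro powr_mono) (auto simp: divide_le_eq)
    then have k: "1 < \<kappa>" "\<kappa> \<le> (height j)\<^sup>2"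
      using h1 r by (auto simp: \<kappa>_def gr_one_powr)
    note sets = I_sets[OF k]
    have "(0 * (\<kappa> - 1) + coef j * height j) / (\<kappa> + 1) \<le> avg (I \<kappa> j) W"
      using W_on_I[OF k] W_ge_1 by (intro I_integral_ge[OF k] W_set_integrable sets) (auto intro: order_trans[OF zero_le_one])
    moreover have "coef j * height j / (2 * \<kappa>) \<le> coef j * height j / (\<kappa> + 1)"
      using k h1 coef_nonneg[of j] by (intro divide_left_mono) auto
    ultimately have lower: "coef j * height j / (2 * \<kappa>) \<le> avg (I \<kappa> j) W" by simp
    \<comment> \<open>The root is 1 on the flat part and at most \<open>\<kappa>\<close> on the
      climbing flank and the plateau together, a set of length \<open>2 * eta j\<close>; this keeps
      the mean at most 3.\<close>
    have "(LINT x:I \<kappa> j|lborel. ?w x)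
        \<le> (\<integral>x. indicator (I \<kappa> j) x *\<^sub>R 1 + indicator {p j - eta j..p j + eta j} x *\<^sub>R \<kappa> \<partial>lborel)"
      unfolding set_lebesgue_integral_def
    proof (rule integral_mono)
      show "integrable lborel (\<lambda>x. indicator (I \<kappa> j) x *\<^sub>R ?w x)"
        using set_integrable_root_W[OF r sets] by (simp add: set_integrable_def)
      show "integrable lborel (\<lambda>x. indicator (I \<kappa> j) x *\<^sub>R 1 + indicator {p j - eta j..p j + eta j} x *\<^sub>R \<kappa>)"
        using sets by (intro Bochner_Integration.integrable_add integrable_scaleR_left integrable_real_indicator)
          (auto simp: emeasure_lborel_Icc_eq)
      fix x
      show "indicator (I \<kappa> j) x *\<^sub>R ?w x \<le> indicator (I \<kappa> j) x *\<^sub>R 1 + indicator {p j - eta j..p j + eta j} x *\<^sub>R \<kappa>"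
      proof (cases "x \<in> I \<kappa> j")
        case True
        show ?thesis
        proof (cases "x \<le> p j - eta j")
          case True
          then have "W x = 1" using W_on_I(1)[OF k \<open>x \<in> I \<kappa> j\<close>] by simp
          then show ?thesis using k by (simp add: indicator_def)
        next
          case False
          have "?w x \<le> \<kappa>" unfolding \<kappa>_def
            using W_on_I(3)[OF k True] W_ge_1[of x] r by (intro powr_mono2) auto
          then show ?thesis using True False by (auto simp: indicator_def I_def)
        qed
      qed (use k in \<open>simp add: indicator_def\<close>)
    qed
    also have "\<dots> = (\<kappa> + 1) * eta j + 2 * eta j * \<kappa>"
      using measure_I[OF k] sets eta_pos[of j]
      by (subst Bochner_Integration.integral_add) (auto intro!: integrable_scaleR_left integrable_real_indicator)
    finally have "(LINT x:I \<kappa> j|lborel. ?w x) \<le> 3 * ((\<kappa> + 1) * eta j)"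
      using eta_pos[of j] k by (simp add: algebra_simps)
    then have upper: "avg (I \<kappa> j) ?w \<le> 3"
      unfolding avg_def measure_I[OF k] using eta_pos[of j] k by (simp add: divide_le_eq)
    have "0 \<le> avg (I \<kappa> j) ?w"
      unfolding avg_def set_lebesgue_integral_def by (intro divide_nonneg_nonneg integral_nonneg_AE) auto
    then have "C * avg (I \<kappa> j) ?w \<le> \<bar>C\<bar> * 3" using upper by (intro mult_mono) auto
    then have "avg (I \<kappa> j) W powr (1 / r) \<le> 3 * \<bar>C\<bar>" using C[OF I_interval[OF k]] by (smt (verit))
    then have "(avg (I \<kappa> j) W powr (1 / r)) powr r \<le> (3 * \<bar>C\<bar>) powr r"
      using r by (intro powr_mono2) auto
    moreover have "0 \<le> avg (I \<kappa> j) W"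
      by (rule order_trans[OF _ lower]) (use h1 k coef_nonneg[of j] in auto)
    ultimately have "avg (I \<kappa> j) W \<le> (3 * \<bar>C\<bar>) powr r" using r by (simp add: powr_powr)
    moreover have "\<theta> / 2 * 2 ^ Suc j \<le> coef j * height j / (2 * \<kappa>)"
    proof -
      \<comment> \<open>The quotient \<open>height j / \<kappa>\<close> is still exponential in
        \<open>4 ^ Suc j\<close>; a linear lower bound is enough to beat the coefficient.\<close>
      have "\<theta> * 4 ^ Suc j \<le> exp (\<theta> * 4 ^ Suc j)"
        using exp_ge_add_one_self[of "\<theta> * 4 ^ Suc j"] by linarith
      also have "\<dots> = height j / \<kappa>"
        by (simp add: height_def \<kappa>_def powr_def \<theta>_def flip: exp_diff) (simp add: algebra_simps)
      finally have "coef j * (\<theta> * 4 ^ Suc j) \<le> coef j * (height j / \<kappa>)"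
        by (intro mult_left_mono coef_nonneg)
      moreover have "coef j * 4 ^ Suc j = 2 ^ Suc j"
        using coef_ln_height[of j] by (simp add: height_def)
      ultimately have "\<theta> * 2 ^ Suc j \<le> coef j * (height j / \<kappa>)" by (metis mult.left_commute)
      then show ?thesis by simp
    qed
    ultimately show ?thesis using lower by linarith
  qed
  then show False by (rule two_power_unbounded[rotated]) (use \<theta> in simp)
qed

section \<open>Mean oscillation of the logarithmic sum\<close>

lemma \<phi>_set_integrable: "E \<in> sets lborel \<Longrightarrow> set_integrable lborel E \<phi>"
  unfolding set_integrable_def by (intro integrable_mult_indicator \<phi>_integrable)

lemma locint_\<phi>: "locint D \<phi>"
  by (cases D) (auto intro!: \<phi>_set_integrable)

text \<open>On one third of \<open>I 2 j\<close> the function is 0 and on another it is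
  \<open>2 ^ Suc j\<close>; no constant, and so not the mean \<open>m\<close>, is close to
  both.\<close>

lemma \<phi>_not_in_BMO: "\<phi> \<notin> BMO D"
proof
  assume "\<phi> \<in> BMO D"
  then obtain C where C: "\<And>I. I \<in> intervals D \<Longrightarrow> osc I \<phi> \<le> C"
    unfolding BMO_def BMO_cond_def by blast
  have "1 / 3 * 2 ^ Suc j \<le> C" for j
  proof -
    have k: "(1::real) < 2" "2 \<le> (height j)\<^sup>2" using two_le_height_square by auto
    note sets = I_sets[OF k]
    define m where "m = avg (I 2 j) \<phi>"
    have \<phi>: "\<phi> x = coef j * L j x" if "x \<in> I 2 j" for x using that I_subset[OF k] by (intro \<phi>_eq) auto
    have "(\<bar>m\<bar> * (2 - 1) + \<bar>2 ^ Suc j - m\<bar>) / (2 + 1) \<le> avg (I 2 j) (\<lambda>x. \<bar>\<phi> x - m\<bar>)"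
    proof (rule I_integral_ge[OF k])
      show "set_integrable lborel (I 2 j) (\<lambda>x. \<bar>\<phi> x - m\<bar>)"
        using sets unfolding I_def
        by (intro set_integrable_abs set_integral_diff(1) \<phi>_set_integrable borel_integrable_atLeastAtMost') auto
      show "\<bar>m\<bar> \<le> \<bar>\<phi> x - m\<bar>" if "x \<in> I 2 j" "x \<le> p j - eta j" for x
        using \<phi>[OF that(1)] L_eq_0[OF V_left[OF that(2)]] by simp
      show "\<bar>2 ^ Suc j - m\<bar> \<le> \<bar>\<phi> x - m\<bar>" if "x \<in> I 2 j" "p j \<le> x" for x
        using \<phi>[OF that(1)] V_top[OF that(2)] that(1) coef_ln_height[of j] by (simp add: L_def I_def)
    qed simp
    also have "\<dots> \<le> C" using C[OF I_interval[OF k]] by (simp add: osc_def m_def)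
    finally have "(\<bar>m\<bar> * (2 - 1) + \<bar>2 ^ Suc j - m\<bar>) / (2 + 1) \<le> C" .
    moreover have "2 ^ Suc j \<le> \<bar>m\<bar> + \<bar>2 ^ Suc j - m\<bar>" by linarith
    ultimately show ?thesis by simp
  qed
  then show False by (rule two_power_unbounded[rotated]) simp
qed

lemma \<phi>_in_BMOn:
  assumes n: "n \<in> S"
  shows "\<phi> \<in> BMOn n D"
proof -
  have "osc J \<phi> \<le> 4" if J: "J \<in> nadic n D" for J
  proof -
    obtain a b where ab: "J = {a..<b}" "a < b" by (rule nadic_Ico[OF J S_ge[OF n]])
    have "\<exists>m\<ge>0. (\<forall>x\<in>{a..<b}. m \<le> L j x) \<and> (LINT x:{a..<b}|lborel. L j x) \<le> (m + 2) * (b - a)" for j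
      by (rule L_excess[OF n _ ab(2)]) (use nadic_subset_all[OF J] ab(1) in auto)
    then obtain m where m: "\<And>j. 0 \<le> m j" "\<forall>j. \<forall>x\<in>{a..<b}. m j \<le> L j x"
      "\<And>j. (LINT x:{a..<b}|lborel. L j x) \<le> (m j + 2) * (b - a)" by metis
    have e: "(\<lambda>j. coef j * 2) sums (1 * 2)" by (rule sums_mult2[OF coef_sums])
    show ?thesis
      using osc_\<phi>_le[OF ab(2) m sums_summable[OF e]] sums_unique[OF e] ab(1) by simp
  qed
  then show ?thesis unfolding BMOn_def BMO_cond_def using locint_\<phi> by blast
qed

end

section \<open>Vanishing mean oscillation and Hardy spaces\<close>

context bump_chain
begin

lemma L_uniformly_continuous:
  assumes "0 < \<epsilon>"
  obtains \<delta> where "0 < \<delta>" "\<And>x y. \<bar>x - y\<bar> < \<delta> \<Longrightarrow> \<bar>L j x - L j y\<bar> < \<epsilon>"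
proof -
  have "uniformly_continuous_on {0..1} (L j)"
    by (intro compact_uniformly_continuous continuous_on_L) auto
  then obtain \<delta> where \<delta>: "0 < \<delta>"
    "\<And>x y. x \<in> {0..1} \<Longrightarrow> y \<in> {0..1} \<Longrightarrow> \<bar>x - y\<bar> < \<delta> \<Longrightarrow> \<bar>L j x - L j y\<bar> < \<epsilon>"
    using assms unfolding uniformly_continuous_on_def dist_real_def by metis
  \<comment> \<open>Since \<open>L j\<close> vanishes outside the open unit interval, clamping the
    argument extends uniform continuity from the compact interval to the line.\<close>
  have clamp: "L j x = L j (max 0 (min 1 x))" for x
  proof (cases "x \<in> {0..1}")
    case False
    have "L j y = 0" if "y \<le> 0 \<or> 1 \<le> y" for y
      using that interval_subset[of j] by (intro L_eq_0 V_support) auto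
    then show ?thesis using False by (metis atLeastAtMost_iff max.absorb1 max_def min.absorb1 min.absorb2 nle_le)
  qed simp
  show thesis
  proof (rule that[OF \<delta>(1)])
    fix x y :: real assume xy: "\<bar>x - y\<bar> < \<delta>"
    have "\<bar>max 0 (min 1 x) - max 0 (min 1 y)\<bar> \<le> \<bar>x - y\<bar>" by (simp add: max_def min_def)
    then have "\<bar>L j (max 0 (min 1 x)) - L j (max 0 (min 1 y))\<bar> < \<epsilon>"
      using xy by (intro \<delta>(2)) auto
    then show "\<bar>L j x - L j y\<bar> < \<epsilon>" by (simp only: clamp[symmetric])
  qed
qed

text \<open>The tail of the sum has small coefficients and the uniform bound 2 of
  \<open>L_excess\<close>; the finitely many remaining logarithms are uniformly continuous. Tail and
  head each contribute at most \<open>\<epsilon> / 4\<close>, and the passage to \<open>osc\<close>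
  doubles the total.\<close>

lemma osc_\<phi>_small:
  assumes n: "n \<in> S" and \<epsilon>: "0 < \<epsilon>"
  obtains \<delta> where "0 < \<delta>" "\<And>a b. {a..<b} \<in> nadic_all n \<Longrightarrow> a < b \<Longrightarrow> b - a < \<delta> \<Longrightarrow> osc {a..<b} \<phi> \<le> \<epsilon>"
proof -
  obtain N where N: "\<bar>\<Sum>i. coef (i + N)\<bar> < \<epsilon> / 8"
    using suminf_exist_split[of "\<epsilon> / 8", OF _ coef_summable] \<epsilon> by auto
  define e where "e j = (if j < N then \<epsilon> / 4 else 2)" for j
  have es: "summable (\<lambda>j. coef j * e j)"
  proof (rule summable_comparison_test'[where N=0, OF summable_mult2[OF coef_summable, of "\<epsilon> / 4 + 2"]])
    fix j :: nat
    have "0 \<le> e j" "e j \<le> \<epsilon> / 4 + 2" using \<epsilon> by (auto simp: e_def)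
    then show "norm (coef j * e j) \<le> coef j * (\<epsilon> / 4 + 2)"
      using coef_nonneg[of j] by (simp add: abs_mult mult_left_mono del: times_divide_eq_right)
  qed
  have "(\<Sum>j. coef j * e j) = (\<Sum>i. coef (i + N) * e (i + N)) + (\<Sum>j<N. coef j * e j)"
    by (rule suminf_split_initial_segment[OF es])
  also have "(\<Sum>i. coef (i + N) * e (i + N)) = (\<Sum>i. coef (i + N)) * 2"
    using suminf_mult2[of "\<lambda>i. coef (i + N)" 2] coef_summable by (simp add: e_def summable_iff_shift)
  also have "(\<Sum>j<N. coef j * e j) = (\<Sum>j<N. coef j) * (\<epsilon> / 4)"
    unfolding sum_distrib_right by (rule sum.cong) (auto simp: e_def)
  also have "\<dots> \<le> 1 * (\<epsilon> / 4)"
    using sum_le_suminf[OF coef_summable, of "{..<N}"] coef_nonneg \<epsilon> sums_unique[OF coef_sums]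
    by (intro mult_right_mono) auto
  finally have e: "2 * (\<Sum>j. coef j * e j) \<le> \<epsilon>" using N by (simp add: abs_less_iff)
  have "\<exists>\<delta>>0. \<forall>x y. \<bar>x - y\<bar> < \<delta> \<longrightarrow> \<bar>L j x - L j y\<bar> < \<epsilon> / 8" for j
    using L_uniformly_continuous[of "\<epsilon> / 8" j] \<epsilon> by (metis zero_less_divide_iff zero_less_numeral)
  then obtain \<delta>' where \<delta>': "\<And>j. 0 < \<delta>' j" "\<And>j x y. \<bar>x - y\<bar> < \<delta>' j \<Longrightarrow> \<bar>L j x - L j y\<bar> < \<epsilon> / 8"
    by metis
  define \<delta> where "\<delta> = Min (insert 1 (\<delta>' ` {..<N}))"
  have \<delta>: "0 < \<delta>" "\<And>j. j < N \<Longrightarrow> \<delta> \<le> \<delta>' j" using \<delta>' by (auto simp: \<delta>_def)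
  show thesis
  proof (rule that[OF \<delta>(1)])
    fix a b assume J: "{a..<b} \<in> nadic_all n" and ab: "a < b" and len: "b - a < \<delta>"
    have "\<exists>m\<ge>0. (\<forall>x\<in>{a..<b}. m \<le> L j x) \<and> (LINT x:{a..<b}|lborel. L j x) \<le> (m + e j) * (b - a)" for j
    proof (cases "j < N")
      case True
      have close: "\<bar>L j x - L j a\<bar> < \<epsilon> / 8" if "x \<in> {a..<b}" for x
        using that len \<delta>(2)[OF True] by (intro \<delta>'(2)) auto
      have "(LINT x:{a..<b}|lborel. L j x) \<le> (LINT x:{a..<b}|lborel. L j a + \<epsilon> / 8)"
      proof (intro set_integral_mono set_integrable_L set_integrable_const_Ico)
        show "L j x \<le> L j a + \<epsilon> / 8" if "x \<in> {a..<b}" for x using close[OF that] by linarith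
      qed
      also have "\<dots> = (L j a + \<epsilon> / 8) * (b - a)" using ab by (simp add: set_integral_const_Ico)
      \<comment> \<open>Lower bounds have to be nonnegative, hence the truncation at 0; two
        deviations of \<open>\<epsilon> / 8\<close> make up
        \<open>e j = \<epsilon> / 4\<close>.\<close>
      also have "\<dots> \<le> (max 0 (L j a - \<epsilon> / 8) + e j) * (b - a)"
        using ab True by (intro mult_right_mono) (auto simp: e_def)
      finally have "(LINT x:{a..<b}|lborel. L j x) \<le> (max 0 (L j a - \<epsilon> / 8) + e j) * (b - a)" .
      moreover have "max 0 (L j a - \<epsilon> / 8) \<le> L j x" if "x \<in> {a..<b}" for x
        using close[OF that] L_nonneg[of j x] by linarith
      ultimately show ?thesis by (intro exI[of _ "max 0 (L j a - \<epsilon> / 8)"]) auto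
    next
      case False
      then show ?thesis using L_excess[OF n J ab, of j] by (simp add: e_def)
    qed
    then obtain m where m: "\<And>j. 0 \<le> m j" "\<forall>j. \<forall>x\<in>{a..<b}. m j \<le> L j x"
      "\<And>j. (LINT x:{a..<b}|lborel. L j x) \<le> (m j + e j) * (b - a)" by metis
    show "osc {a..<b} \<phi> \<le> \<epsilon>" using osc_\<phi>_le[OF ab m es] e by simp
  qed
qed

lemma \<phi>_eq_0: "1 \<le> \<bar>x\<bar> \<Longrightarrow> \<phi> x = 0"
proof -
  assume "1 \<le> \<bar>x\<bar>"
  then have "L j x = 0" for j using interval_subset[of j] by (intro L_eq_0 V_support) auto
  then show ?thesis by (simp add: \<phi>_def)
qed

lemma osc_\<phi>_le_integral:
  assumes "a < b"
  shows "osc {a..<b} \<phi> \<le> 2 * ((LINT x:{a..<b}|lborel. \<phi> x) / (b - a))"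
proof -
  have "\<bar>\<phi> x - 0\<bar> = \<phi> x" for x using \<phi>_nonneg[of x] by simp
  then show ?thesis using osc_le[OF assms \<phi>_set_integrable, of 0] by simp
qed

text \<open>Large and distant intervals are harmless because \<open>\<phi>\<close> is integrable and
  vanishes for \<open>\<bar>x\<bar> \<ge> 1\<close>; the small intervals are the substance.\<close>

lemma \<phi>_in_VMOn:
  assumes n: "n \<in> S"
  shows "\<phi> \<in> VMOn n D"
proof -
  have a: "\<exists>\<delta>>0. \<forall>I\<in>nadic n D. measure lborel I < \<delta> \<longrightarrow> osc I \<phi> \<le> \<epsilon>" if \<epsilon>: "0 < \<epsilon>" for \<epsilon>
  proof -
    obtain \<delta> where \<delta>: "0 < \<delta>"
      "\<And>a b. {a..<b} \<in> nadic_all n \<Longrightarrow> a < b \<Longrightarrow> b - a < \<delta> \<Longrightarrow> osc {a..<b} \<phi> \<le> \<epsilon>"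
      using osc_\<phi>_small[OF n \<epsilon>] by metis
    have "osc J \<phi> \<le> \<epsilon>" if J: "J \<in> nadic n D" "measure lborel J < \<delta>" for J
    proof -
      obtain a b where ab: "J = {a..<b}" "a < b" by (rule nadic_Ico[OF J(1) S_ge[OF n]])
      then show ?thesis using \<delta>(2)[of a b] J nadic_subset_all by auto
    qed
    then show ?thesis using \<delta>(1) by blast
  qed
  have b: "\<exists>N. \<forall>I\<in>nadic n D. measure lborel I > N \<longrightarrow> osc I \<phi> \<le> \<epsilon>" if \<epsilon>: "0 < \<epsilon>" for \<epsilon>
  proof -
    let ?M = "\<integral>x. \<phi> x \<partial>lborel"
    have "osc J \<phi> \<le> \<epsilon>" if J: "J \<in> nadic n D" "measure lborel J > 2 * ?M / \<epsilon>" for J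
    proof -
      obtain a b where ab: "J = {a..<b}" "a < b" by (rule nadic_Ico[OF J(1) S_ge[OF n]])
      have "(LINT x:{a..<b}|lborel. \<phi> x) \<le> ?M"
        unfolding set_lebesgue_integral_def
        using \<phi>_set_integrable[of "{a..<b}"] \<phi>_nonneg
        by (intro integral_mono \<phi>_integrable) (auto simp: set_integrable_def indicator_def)
      then have "(LINT x:{a..<b}|lborel. \<phi> x) / (b - a) \<le> ?M / (b - a)"
        using ab by (intro divide_right_mono) auto
      moreover have "2 * (?M / (b - a)) \<le> \<epsilon>" using J(2) ab \<epsilon> by (simp add: field_simps)
      ultimately show ?thesis using osc_\<phi>_le_integral[OF ab(2)] ab(1) by simp
    qed
    then show ?thesis by blast
  qed
  have c: "\<exists>R. \<forall>I\<in>nadic n D. I \<inter> ball 0 R = {} \<longrightarrow> osc I \<phi> \<le> \<epsilon>" if \<epsilon>: "0 < \<epsilon>" for \<epsilon>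
  proof -
    have "osc J \<phi> \<le> \<epsilon>" if J: "J \<in> nadic n D" "J \<inter> ball 0 1 = {}" for J
    proof -
      obtain a b where ab: "J = {a..<b}" "a < b" by (rule nadic_Ico[OF J(1) S_ge[OF n]])
      have "\<phi> x = 0" if "x \<in> {a..<b}" for x
      proof (rule \<phi>_eq_0)
        have "x \<notin> ball 0 1" using that J(2) ab(1) by blast
        then show "1 \<le> \<bar>x\<bar>" by simp
      qed
      then have "(LINT x:{a..<b}|lborel. \<phi> x) = (LINT x:{a..<b}|lborel. 0)"
        by (intro set_lebesgue_integral_cong) auto
      then have "(LINT x:{a..<b}|lborel. \<phi> x) = 0" by (simp add: set_lebesgue_integral_def)
      then show ?thesis using osc_\<phi>_le_integral[OF ab(2)] ab(1) \<epsilon> by simp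
    qed
    then show ?thesis by blast
  qed
  have "VMO_cond D (nadic n D) \<phi>" by (cases D) (use a b c in auto)
  then show ?thesis unfolding VMOn_def using \<phi>_in_BMOn[OF n] by blast
qed

section \<open>Pairing the logarithms with Hardy space functions\<close>

lemma L_le_ln_height: "L j x \<le> ln (height j)"
  unfolding L_def using V_nonneg[of j x] V_le[of j x] by (intro ln_mono) auto

lemma L_measurable: "L j \<in> borel_measurable lborel"
  using borel_measurable_continuous_onI[OF continuous_on_L] by simp

text \<open>The \<open>n\<close>-adic half of the \<open>H\<^sup>1\<close>-\<open>BMO\<close> duality: on an \<open>n\<close>-adic interval the mean of
  \<open>L j\<close> exceeds its infimum by at most 2, so its pairing with an \<open>n\<close>-adic atom is bounded uniformly in \<open>j\<close>.\<close>

lemma atom_pairing: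
  assumes n: "n \<in> S" and h: "atom (nadic n D) h"
  shows "integrable lborel (\<lambda>x. L j x * h x)" "\<bar>\<integral>x. L j x * h x \<partial>lborel\<bar> \<le> 2"
    "(\<integral>x. \<bar>L j x * h x\<bar> \<partial>lborel) \<le> ln (height j)"
proof -
  obtain J where J: "J \<in> nadic n D" and meas: "h \<in> borel_measurable lborel"
    and supp: "\<And>x. x \<notin> J \<Longrightarrow> h x = 0" and mean: "(LINT x:J|lborel. h x) = 0"
    and bd: "\<And>x. \<bar>h x\<bar> \<le> 1 / measure lborel J"
    using h unfolding atom_def by blast
  obtain a b where ab: "J = {a..<b}" "a < b" by (rule nadic_Ico[OF J S_ge[OF n]])
  obtain m where m: "m \<ge> 0" "\<forall>x\<in>{a..<b}. m \<le> L j x" "(LINT x:{a..<b}|lborel. L j x) \<le> (m + 2) * (b - a)"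
    using L_excess[OF n _ ab(2), of j] nadic_subset_all[OF J] ab(1) by auto
  have bd': "\<bar>h x\<bar> \<le> 1 / (b - a)" for x using bd[of x] ab by simp
  have i1: "set_integrable lborel {a..<b} h"
    by (rule set_integrable_bounded[OF meas _ _ bd']) (use ab in auto)
  have bd2: "\<bar>L j x * h x\<bar> \<le> ln (height j) * (1 / (b - a))" for x
    unfolding abs_mult using L_nonneg[of j x] L_le_ln_height[of j x] bd' ab by (intro mult_mono) auto
  have i2: "set_integrable lborel {a..<b} (\<lambda>x. L j x * h x)"
    by (rule set_integrable_bounded[OF borel_measurable_times[OF L_measurable meas] _ _ bd2]) (use ab in auto)
  have eq: "indicator {a..<b} x *\<^sub>R (L j x * h x) = L j x * h x" for x
    using supp[of x] ab(1) by (auto simp: indicator_def)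
  have eq': "indicator {a..<b} x *\<^sub>R \<bar>L j x * h x\<bar> = \<bar>L j x * h x\<bar>" for x
    using supp[of x] ab(1) by (auto simp: indicator_def)
  show "integrable lborel (\<lambda>x. L j x * h x)" using i2 unfolding set_integrable_def eq .
  have "(\<integral>x. \<bar>L j x * h x\<bar> \<partial>lborel) = (LINT x:{a..<b}|lborel. \<bar>L j x * h x\<bar>)"
    unfolding set_lebesgue_integral_def eq' ..
  also have "\<dots> \<le> (LINT x:{a..<b}|lborel. ln (height j) * (1 / (b - a)))"
    by (intro set_integral_mono set_integrable_abs i2 set_integrable_const_Ico bd2)
  also have "\<dots> = ln (height j)" using ab by (subst set_integral_const_Ico) auto
  finally show "(\<integral>x. \<bar>L j x * h x\<bar> \<partial>lborel) \<le> ln (height j)" .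
  have iL: "set_integrable lborel {a..<b} (\<lambda>x. L j x - m)"
    by (intro set_integral_diff(1) set_integrable_L set_integrable_const_Ico)
  have im: "set_integrable lborel {a..<b} (\<lambda>x. m * h x)" using i1 by (rule set_integrable_mult_right)
  have id: "set_integrable lborel {a..<b} (\<lambda>x. L j x * h x - m * h x)"
    by (rule set_integral_diff(1)[OF i2 im])
  have "(\<integral>x. L j x * h x \<partial>lborel) = (LINT x:{a..<b}|lborel. L j x * h x)"
    unfolding set_lebesgue_integral_def eq ..
  also have "\<dots> = (LINT x:{a..<b}|lborel. L j x * h x - m * h x)"
    using mean ab(1) by (simp add: set_integral_diff(2)[OF i2 im])
  finally have "\<bar>\<integral>x. L j x * h x \<partial>lborel\<bar> \<le> (LINT x:{a..<b}|lborel. \<bar>L j x * h x - m * h x\<bar>)"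
    using set_integral_norm_bound[OF id] by simp
  also have "\<dots> \<le> (LINT x:{a..<b}|lborel. (1 / (b - a)) * (L j x - m))"
  proof (intro set_integral_mono set_integrable_abs id set_integrable_mult_right iL)
    fix x assume x: "x \<in> {a..<b}"
    have "\<bar>L j x * h x - m * h x\<bar> = (L j x - m) * \<bar>h x\<bar>"
      using m(2) x by (simp add: abs_mult flip: left_diff_distrib)
    also have "\<dots> \<le> (L j x - m) * (1 / (b - a))" using m(2) x bd' by (intro mult_left_mono) auto
    finally show "\<bar>L j x * h x - m * h x\<bar> \<le> (1 / (b - a)) * (L j x - m)" by (simp add: mult.commute)
  qed
  also have "\<dots> = (1 / (b - a)) * ((LINT x:{a..<b}|lborel. L j x) - m * (b - a))"
    using ab(2) by (simp add: set_integral_diff(2)[OF set_integrable_L set_integrable_const_Ico] set_integral_const_Ico)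
  also have "\<dots> \<le> (1 / (b - a)) * (2 * (b - a))"
    using m(3) ab by (intro mult_left_mono) (auto simp: algebra_simps)
  also have "\<dots> = 2" using ab(2) by (simp add: field_simps)
  finally show "\<bar>\<integral>x. L j x * h x \<partial>lborel\<bar> \<le> 2" .
qed

text \<open>For fixed \<open>j\<close> the crude bound \<open>ln (height j)\<close> justifies
  integrating the atomic series term by term; the bound 2 per atom then makes \<open>B\<close>
  independent of \<open>j\<close>. The function \<open>h\<close> stands in for the product because
  \<open>g\<close> is the sum of its series only almost everywhere and need not be Borel
  measurable.\<close>

lemma H1n_pairing:
  assumes n: "n \<in> S" and g: "g \<in> H1n n D"
  obtains B where "\<And>j. \<exists>h. integrable lborel h \<and> \<bar>\<integral>x. h x \<partial>lborel\<bar> \<le> B \<and> (AE x in lborel. h x = L j x * g x)"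
proof -
  obtain c :: "nat \<Rightarrow> real" and u where c: "summable (\<lambda>i. \<bar>c i\<bar>)" and u: "\<And>i. atom (nadic n D) (u i)"
    and sums: "AE x in lborel. (\<lambda>i. c i * u i x) sums g x"
    using g unfolding H1n_def atomic_H1_def by blast
  have "\<exists>h. integrable lborel h \<and> \<bar>\<integral>x. h x \<partial>lborel\<bar> \<le> 2 * (\<Sum>i. \<bar>c i\<bar>) \<and> (AE x in lborel. h x = L j x * g x)" for j
  proof -
    define f where "f i x = c i * (L j x * u i x)" for i x
    note pair = atom_pairing[OF n u, of j]
    have fi: "integrable lborel (f i)" for i
      unfolding f_def[abs_def] by (intro integrable_mult_right pair)
    have norm: "(\<integral>x. norm (f i x) \<partial>lborel) \<le> \<bar>c i\<bar> * ln (height j)" for i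
      unfolding f_def using pair(3)[of i] by (simp add: abs_mult mult_left_mono flip: mult.assoc)
        (simp add: mult_left_mono mult.assoc)
    have s: "summable (\<lambda>i. \<bar>c i\<bar> * ln (height j))" by (rule summable_mult2[OF c])
    have sn: "summable (\<lambda>i. \<integral>x. norm (f i x) \<partial>lborel)"
      by (rule summable_comparison_test'[OF s, where N=0]) (use norm in simp)
    have "(\<integral>\<^sup>+x. (\<Sum>i. ennreal (norm (f i x))) \<partial>lborel) = (\<Sum>i. \<integral>\<^sup>+x. ennreal (norm (f i x)) \<partial>lborel)"
      using fi by (intro nn_integral_suminf) auto
    also have "\<dots> = (\<Sum>i. ennreal (\<integral>x. norm (f i x) \<partial>lborel))"
      using fi by (intro suminf_cong nn_integral_eq_integral) auto
    also have "\<dots> \<noteq> \<infinity>" unfolding infinity_ennreal_def by (intro ennreal_suminf_neq_top sn) auto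
    finally have "AE x in lborel. (\<Sum>i. ennreal (norm (f i x))) \<noteq> \<infinity>"
      using fi by (intro nn_integral_noteq_infinite) auto
    then have ae: "AE x in lborel. summable (\<lambda>i. norm (f i x))"
      by eventually_elim (auto intro!: summable_suminf_not_top)
    note S = fi ae sn
    have le: "norm (\<integral>x. f i x \<partial>lborel) \<le> \<bar>c i\<bar> * 2" for i
      unfolding f_def using pair(2)[of i] by (simp add: abs_mult mult_left_mono)
    have "\<bar>\<Sum>i. \<integral>x. f i x \<partial>lborel\<bar> \<le> (\<Sum>i. \<bar>c i\<bar> * 2)"
    proof -
      have "summable (\<lambda>i. norm (\<integral>x. f i x \<partial>lborel))"
        by (rule summable_comparison_test'[OF summable_mult2[OF c], where N=0]) (use le in simp)
      then have "norm (\<Sum>i. \<integral>x. f i x \<partial>lborel) \<le> (\<Sum>i. norm (\<integral>x. f i x \<partial>lborel))"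
        by (rule summable_norm)
      also have "\<dots> \<le> (\<Sum>i. \<bar>c i\<bar> * 2)"
        by (intro suminf_le le summable_mult2 c) fact
      finally show ?thesis by simp
    qed
    then have "\<bar>\<integral>x. (\<Sum>i. f i x) \<partial>lborel\<bar> \<le> 2 * (\<Sum>i. \<bar>c i\<bar>)"
      using integral_suminf[OF S] suminf_mult2[OF c, of 2] by simp
    moreover have "AE x in lborel. (\<Sum>i. f i x) = L j x * g x"
      using sums
    proof eventually_elim
      case (elim x)
      from sums_mult[OF this, of "L j x"] show ?case
        by (simp add: f_def sums_iff mult.left_commute)
    qed
    ultimately show ?thesis using integrable_suminf[OF S] by blast
  qed
  then show thesis by (rule that)
qed

text \<open>An atom on \<open>I 2 j\<close>, whose length is \<open>3 * eta j\<close>: positive on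
  the plateau of bump \<open>j\<close>, negative on the third where \<open>L j\<close> vanishes, so
  that nothing cancels in the pairing with \<open>L j\<close>.\<close>

definition \<beta> :: "nat \<Rightarrow> real \<Rightarrow> real" where
  "\<beta> j x = (indicator {p j..p j + eta j} x - indicator {p j - 2 * eta j..p j - eta j} x) / (3 * eta j)"

definition G :: "real \<Rightarrow> real" where
  "G x = (\<Sum>j. coef j * \<beta> j x)"

lemma \<beta>_atom: "atom (intervals D) (\<beta> j)"
proof -
  have k: "(1::real) < 2" "2 \<le> (height j)\<^sup>2" using two_le_height_square by auto
  have eq: "indicator (I 2 j) x *\<^sub>R \<beta> j x = \<beta> j x" for x
    using eta_pos[of j] by (auto simp: \<beta>_def I_def indicator_def)
  have int: "integrable lborel (\<lambda>x. indicator {y..z} x :: real)" for y z :: real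
    by (intro integrable_real_indicator) (auto simp: emeasure_lborel_Icc_eq)
  have "(LINT x:I 2 j|lborel. \<beta> j x) = 0"
    unfolding set_lebesgue_integral_def eq unfolding \<beta>_def
    using eta_pos[of j] by (simp add: Bochner_Integration.integral_diff[OF int int])
  moreover have "\<beta> j \<in> borel_measurable lborel" unfolding \<beta>_def[abs_def] by measurable
  moreover have "\<beta> j x = 0" if "x \<notin> I 2 j" for x using eq[of x] that by simp
  moreover have "\<bar>\<beta> j x\<bar> \<le> 1 / measure lborel (I 2 j)" for x
    unfolding measure_I[OF k] using eta_pos[of j] by (auto simp: \<beta>_def indicator_def)
  ultimately show ?thesis unfolding atom_def using I_interval[OF k] by blast
qed

lemma \<beta>_support: "x \<notin> {p j - d j..p j + d j} \<Longrightarrow> \<beta> j x = 0"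
proof -
  assume x: "x \<notin> {p j - d j..p j + d j}"
  have "I 2 j \<subseteq> {p j - d j..p j + d j}" using two_le_height_square by (intro I_subset) auto
  with x have "x \<notin> I 2 j" by blast
  then show ?thesis using eta_pos[of j] by (auto simp: \<beta>_def indicator_def I_def)
qed

lemma G_sums:
  assumes "x \<in> {p j - d j..p j + d j}"
  shows "(\<lambda>i. coef i * \<beta> i x) sums (coef j * \<beta> j x)"
proof -
  have "\<beta> i x = 0" if "i \<noteq> j" for i
    using \<beta>_support[of x i] intervals_disjoint[OF assms, of i] that by blast
  then have "(\<lambda>i. coef i * \<beta> i x) = (\<lambda>i. if i = j then coef i * \<beta> i x else 0)" by auto
  then show ?thesis using sums_single[of j "\<lambda>i. coef i * \<beta> i x"] by simp
qed

lemma G_in_H1: "G \<in> H1 D"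
proof -
  have "summable (\<lambda>i. coef i * \<beta> i x)" for x
  proof (cases "\<exists>j. x \<in> {p j - d j..p j + d j}")
    case True
    then show ?thesis using G_sums sums_summable by blast
  next
    case False
    then have "\<beta> i x = 0" for i using \<beta>_support by blast
    then show ?thesis by simp
  qed
  then have "(\<lambda>i. coef i * \<beta> i x) sums G x" for x unfolding G_def by (rule summable_sums)
  moreover have "summable (\<lambda>i. \<bar>coef i\<bar>)" using coef_summable coef_nonneg by simp
  ultimately show ?thesis unfolding H1_def atomic_H1_def using \<beta>_atom by blast
qed

text \<open>By disjointness of supports \<open>L j\<close> sees only the atom
  \<open>\<beta> j\<close>, and the pairing equals one third of
  \<open>coef j * ln (height j)\<close>.\<close>

lemma L_G_integral: "integrable lborel (\<lambda>x. L j x * G x)" "(\<integral>x. L j x * G x \<partial>lborel) = 2 ^ Suc j / 3"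
proof -
  have eq: "L j x * G x = (2 ^ Suc j / (3 * eta j)) * indicator {p j..p j + eta j} x" for x
  proof (cases "x \<in> {p j - d j..p j + d j}")
    case True
    have "L j x * G x = coef j * L j x * \<beta> j x"
      unfolding G_def using G_sums[OF True] by (simp add: sums_iff)
    also have "\<dots> = (coef j * ln (height j) / (3 * eta j)) * indicator {p j..p j + eta j} x"
      using eta_pos[of j] V_left[of x j] V_top[of j x] by (auto simp: \<beta>_def L_def indicator_def)
    finally show ?thesis unfolding coef_ln_height .
  next
    case False
    then show ?thesis using L_eq_0[OF V_support] eta_le_d[of j] d_pos[of j] by (auto simp: indicator_def)
  qed
  show "integrable lborel (\<lambda>x. L j x * G x)" "(\<integral>x. L j x * G x \<partial>lborel) = 2 ^ Suc j / 3"
    unfolding eq using eta_pos[of j] by (auto intro!: integrable_mult_right integrable_real_indicator simp: field_simps)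
qed

lemma G_not_in_sum_H1n:
  assumes "finite S"
  shows "G \<notin> sum_H1n S D"
proof
  assume "G \<in> sum_H1n S D"
  then obtain g where g: "\<And>n. n \<in> S \<Longrightarrow> g n \<in> H1n n D" and G: "G = (\<lambda>x. \<Sum>n\<in>S. g n x)"
    unfolding sum_H1n_def by blast
  have "\<exists>B. \<forall>j. \<exists>h. integrable lborel h \<and> \<bar>\<integral>x. h x \<partial>lborel\<bar> \<le> B \<and> (AE x in lborel. h x = L j x * g n x)"
    if "n \<in> S" for n
    using H1n_pairing[OF that g[OF that]] by metis
  then obtain B where B: "\<And>n j. n \<in> S \<Longrightarrow> \<exists>h. integrable lborel h \<and> \<bar>\<integral>x. h x \<partial>lborel\<bar> \<le> B n \<and>
      (AE x in lborel. h x = L j x * g n x)"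
    by metis
  \<comment> \<open>The bounds \<open>B n\<close> are fixed before \<open>j\<close>; summing them
    over the finite set \<open>S\<close> contradicts the growth of the pairing with
    \<open>G\<close>.\<close>
  have "1 / 3 * 2 ^ Suc j \<le> (\<Sum>n\<in>S. B n)" for j
  proof -
    have "\<forall>n\<in>S. \<exists>h. integrable lborel h \<and> \<bar>\<integral>x. h x \<partial>lborel\<bar> \<le> B n \<and> (AE x in lborel. h x = L j x * g n x)"
      using B by blast
    from bchoice[OF this] obtain h
      where h: "\<And>n. n \<in> S \<Longrightarrow> integrable lborel (h n)" "\<And>n. n \<in> S \<Longrightarrow> \<bar>\<integral>x. h n x \<partial>lborel\<bar> \<le> B n"
        "\<And>n. n \<in> S \<Longrightarrow> AE x in lborel. h n x = L j x * g n x"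
      by blast
    have "AE x in lborel. \<forall>n\<in>S. h n x = L j x * g n x"
      using h(3) assms by (simp add: AE_ball_countable countable_finite)
    then have ae: "AE x in lborel. L j x * G x = (\<Sum>n\<in>S. h n x)"
      by eventually_elim (simp add: G sum_distrib_left)
    have i: "integrable lborel (\<lambda>x. \<Sum>n\<in>S. h n x)" using h(1) by (intro Bochner_Integration.integrable_sum)
    have "2 ^ Suc j / 3 = (\<integral>x. (\<Sum>n\<in>S. h n x) \<partial>lborel)"
      unfolding L_G_integral(2)[symmetric]
      using L_G_integral(1) i by (intro integral_cong_AE ae) auto
    also have "\<dots> = (\<Sum>n\<in>S. \<integral>x. h n x \<partial>lborel)" using h(1) by (intro Bochner_Integration.integral_sum)
    also have "\<dots> \<le> (\<Sum>n\<in>S. B n)" using h(2) by (intro sum_mono) (auto simp: abs_le_iff)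
    finally show ?thesis by simp
  qed
  then show False by (rule two_power_unbounded[rotated]) simp
qed

end

theorem theorem1p2:
  fixes S :: "nat set" and r :: real and D :: space
  assumes "finite S" and "S \<noteq> {}" and "\<forall>n\<in>S. 2 \<le> n" and "1 < r"
  shows "(\<Inter>n\<in>S. RHn n r D) \<noteq> RH r D \<and>
         (\<Inter>n\<in>S. An n r D) \<noteq> A r D \<and>
         (\<Inter>n\<in>S. BMOn n D) \<noteq> BMO D \<and>
         sum_H1n S D \<noteq> H1 D \<and>
         (\<Inter>n\<in>S. VMOn n D) \<noteq> VMO D"
proof -
  obtain p d where "bump_chain S p d" by (rule bump_chain_exists[OF assms(1,3)])
  then interpret bump_chain S p d .
  have "(\<Inter>n\<in>S. RHn n r D) \<noteq> RH r D"
    using root_W_in_RHn[OF _ assms(4)] root_W_not_in_RH[OF assms(4)] by blast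
  moreover have "(\<Inter>n\<in>S. An n r D) \<noteq> A r D"
    using W_in_An[OF _ assms(4)] W_not_in_A[OF assms(4)] by blast
  moreover have "(\<Inter>n\<in>S. BMOn n D) \<noteq> BMO D"
    using \<phi>_in_BMOn \<phi>_not_in_BMO by blast
  moreover have "sum_H1n S D \<noteq> H1 D"
    using G_in_H1 G_not_in_sum_H1n[OF assms(1)] by blast
  \<comment> \<open>\<open>VMO\<close> is contained in \<open>BMO\<close> by definition, so failure
    of the \<open>BMO\<close> condition also excludes \<open>\<phi>\<close> from
    \<open>VMO\<close>.\<close>
  moreover have "(\<Inter>n\<in>S. VMOn n D) \<noteq> VMO D"
    using \<phi>_in_VMOn \<phi>_not_in_BMO unfolding VMO_def by blast
  ultimately show ?thesis by blast
qed

end
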